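(* Let $\Phi$ be a finite crystallographic root system that is simply laced, and let $I\subseteq\Phi^+$ be an order ideal in the root poset. Then the following assertions are equivalent: (a) $I$ is supersolvable; (b) $I$ is chain peelable; (c) $I$ is not a star ideal.
   Context: Root systems are reduced. Let $\Phi$ be a finite crystallographic root system with positive roots $\Phi^+$ and simple roots $\Delta\subseteq\Phi^+$. Every $\gamma\in\Phi^+$ is uniquely $\gamma=\sum_{\alpha\in\Delta}\gamma_\alpha\alpha$ with nonnegative integers $\gamma_\alpha$. The root poset is the partial order on $\Phi^+$ given by $\gamma\le\gamma'$ iff $\gamma_\alpha\le\gamma'_\alpha$ for all $\alpha\in\Delta$. An order ideal is a subset $I\subseteq\Phi^+$ such that $\gamma_1\in I$ and $\gamma_2<\gamma_1$ imply $\gamma_2\in I$. $\Phi$ is simply laced if its Dynkin diagram has no multiple bonds. An ideal $I\subseteq\Phi^+$ is a star ideal if there are distinct simple roots $\alpha_1,\alpha_2,\alpha_3,\alpha_4\in\Delta$ such that $\alpha_1+\alpha_2+\alpha_3$, $\alpha_1+\alpha_2+\alpha_4$ and $\alpha_2+\alpha_3+\alpha_4$ all are roots that belong to $I$. For a finite set $\mathcal{A}$ of pairwise non-parallel vectors in a Euclidean space (such as $\mathcal{A}=I$), the closure of $S\subseteq\mathcal{A}$ is $\mathrm{cl}(S)=\mathcal{A}\cap\mathrm{span}\,S$; a flat is a closed subset; the rank of a subset is the dimension of its span; a $k$-flat is a flat of rank $k$. $\mathcal{A}$ is supersolvable if, with $n$ the rank of $\mathcal{A}$, there is a partition $\mathcal{A}=\Pi_1\uplus\cdots\uplus\Pi_n$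 such that for all $i\in\{1,\dots,n\}$, setting $\mathcal{A}_i=\Pi_1\uplus\cdots\uplus\Pi_i$: (1) $\mathcal{A}_i$ has rank $i$; (2) no $2$-flat of $\mathcal{A}_i$ is a subset of $\Pi_i$. A chain in a poset is a totally ordered subset; an order filter is the complement of an order ideal. Chain peelings of a finite poset $P$ are defined recursively. If $P$ is a chain, then $P$ is a chain peeling of itself (with one block; the empty poset is chain peelable). Otherwise, a chain peeling of $P$ is a partition $P=P_1\uplus\cdots\uplus P_n$, $n\ge2$, such that $P_n$ is an order filter of $P$ containing a minimal element of $P$, $P_n$ is a chain, and $P_1\uplus\cdots\uplus P_{n-1}$ is a chain peeling of $P\setminus P_n$. $P$ is chain peelable if it has a chain peeling. The ideal $I$ is regarded as a poset with the order induced from the root poset. *)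

theory Defs
  imports "HOL-Analysis.Analysis"
begin

section \<open>Root systems\<close>

text \<open>
  \<open>cartan_int \<beta> \<alpha>\<close> is the Cartan integer \<open>\<langle>\<beta>, \<alpha>\<^sup>\<or>\<rangle> = 2 (\<beta>, \<alpha>) / (\<alpha>, \<alpha>)\<close>, as a real number.
\<close>

definition cartan_int :: "'a::euclidean_space \<Rightarrow> 'a \<Rightarrow> real" where
  "cartan_int \<beta> \<alpha> = 2 * (\<beta> \<bullet> \<alpha>) / (\<alpha> \<bullet> \<alpha>)"

text \<open>
  Finite reduced crystallographic root systems. The roots are not required to span the ambient
  space; in particular the empty root system is allowed.
\<close>

definition root_system :: "'a::euclidean_space set \<Rightarrow> bool" where
  "root_system \<Phi> \<longleftrightarrow>
     finite \<Phi> \<and> 0 \<notin> \<Phi> \<and>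
     (\<forall>\<alpha>\<in>\<Phi>. (\<lambda>\<beta>. \<beta> - cartan_int \<beta> \<alpha> *\<^sub>R \<alpha>) ` \<Phi> = \<Phi>) \<and>
     (\<forall>\<alpha>\<in>\<Phi>. \<forall>\<beta>\<in>\<Phi>. cartan_int \<beta> \<alpha> \<in> \<int>) \<and>
     (\<forall>\<alpha>\<in>\<Phi>. \<forall>c. c *\<^sub>R \<alpha> \<in> \<Phi> \<longrightarrow> c = 1 \<or> c = -1)"

definition positive_roots :: "'a::euclidean_space set \<Rightarrow> 'a set \<Rightarrow> 'a set" where
  "positive_roots \<Phi> \<Delta> = {\<gamma> \<in> \<Phi>. \<exists>c :: 'a \<Rightarrow> nat. \<gamma> = (\<Sum>\<alpha>\<in>\<Delta>. real (c \<alpha>) *\<^sub>R \<alpha>)}"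

text \<open>
  \<open>\<Delta>\<close> is a system of simple roots (a base) of \<open>\<Phi>\<close>; the associated positive system is
  \<open>positive_roots \<Phi> \<Delta>\<close>.
\<close>

definition simple_roots :: "'a::euclidean_space set \<Rightarrow> 'a set \<Rightarrow> bool" where
  "simple_roots \<Phi> \<Delta> \<longleftrightarrow>
     \<Delta> \<subseteq> \<Phi> \<and> independent \<Delta> \<and>
     (\<forall>\<gamma>\<in>\<Phi>. \<gamma> \<in> positive_roots \<Phi> \<Delta> \<or> - \<gamma> \<in> positive_roots \<Phi> \<Delta>)"

text \<open>
  The number of bonds joining two distinct nodes \<open>\<alpha>\<close>, \<open>\<beta>\<close> of the Dynkin diagram.
\<close>

definition dynkin_bonds :: "'a::euclidean_space \<Rightarrow> 'a \<Rightarrow> real" where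
  "dynkin_bonds \<alpha> \<beta> = cartan_int \<alpha> \<beta> * cartan_int \<beta> \<alpha>"

definition simply_laced :: "'a::euclidean_space set \<Rightarrow> bool" where
  "simply_laced \<Delta> \<longleftrightarrow> (\<forall>\<alpha>\<in>\<Delta>. \<forall>\<beta>\<in>\<Delta>. \<alpha> \<noteq> \<beta> \<longrightarrow> dynkin_bonds \<alpha> \<beta> \<le> 1)"

text \<open>
  The coefficient \<open>\<gamma>\<^sub>\<alpha>\<close> is \<open>representation \<Delta> \<gamma> \<alpha>\<close>. The relation is the root poset only when
  restricted to \<open>positive_roots \<Phi> \<Delta>\<close>; outside \<open>span \<Delta>\<close> the function \<open>representation\<close> is a
  dummy value.
\<close>

definition root_le :: "'a::euclidean_space set \<Rightarrow> 'a \<Rightarrow> 'a \<Rightarrow> bool" where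
  "root_le \<Delta> \<gamma> \<gamma>' \<longleftrightarrow> (\<forall>\<alpha>\<in>\<Delta>. representation \<Delta> \<gamma> \<alpha> \<le> representation \<Delta> \<gamma>' \<alpha>)"

section \<open>Order ideals and chain peelings\<close>

text \<open>
  A poset is given by a carrier \<open>P\<close> and a relation \<open>le\<close> of which only the restriction to \<open>P\<close> matters.
\<close>

definition order_ideal :: "('a \<Rightarrow> 'a \<Rightarrow> bool) \<Rightarrow> 'a set \<Rightarrow> 'a set \<Rightarrow> bool" where
  "order_ideal le P J \<longleftrightarrow> J \<subseteq> P \<and> (\<forall>x\<in>J. \<forall>y\<in>P. le y x \<and> y \<noteq> x \<longrightarrow> y \<in> J)"

definition order_filter :: "('a \<Rightarrow> 'a \<Rightarrow> bool) \<Rightarrow> 'a set \<Rightarrow> 'a set \<Rightarrow> bool" where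
  "order_filter le P F \<longleftrightarrow> F \<subseteq> P \<and> order_ideal le P (P - F)"

definition minimal_in :: "('a \<Rightarrow> 'a \<Rightarrow> bool) \<Rightarrow> 'a set \<Rightarrow> 'a \<Rightarrow> bool" where
  "minimal_in le P m \<longleftrightarrow> m \<in> P \<and> (\<forall>x\<in>P. le x m \<longrightarrow> x = m)"

text \<open>
  \<open>chain_peeling le P [P\<^sub>1, \<dots>, P\<^sub>n]\<close>: the blocks are listed in order, and the last one is peeled off
  first. The blocks partition \<open>P\<close> because \<open>F \<subseteq> P\<close> and \<open>Ps\<close> is a chain peeling of \<open>P - F\<close>.
\<close>

inductive chain_peeling :: "('a \<Rightarrow> 'a \<Rightarrow> bool) \<Rightarrow> 'a set \<Rightarrow> 'a set list \<Rightarrow> bool"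
  for le :: "'a \<Rightarrow> 'a \<Rightarrow> bool" where
  chain: "Complete_Partial_Order.chain le P \<Longrightarrow> chain_peeling le P [P]"
| peel: "\<lbrakk>\<not> Complete_Partial_Order.chain le P;
          order_filter le P F; \<exists>m\<in>F. minimal_in le P m;
          Complete_Partial_Order.chain le F;
          chain_peeling le (P - F) Ps\<rbrakk>
         \<Longrightarrow> chain_peeling le P (Ps @ [F])"

definition chain_peelable :: "('a \<Rightarrow> 'a \<Rightarrow> bool) \<Rightarrow> 'a set \<Rightarrow> bool" where
  "chain_peelable le P \<longleftrightarrow> (\<exists>Ps. chain_peeling le P Ps)"

section \<open>Star ideals\<close>

definition star_ideal :: "'a::euclidean_space set \<Rightarrow> 'a set \<Rightarrow> 'a set \<Rightarrow> bool" where
  "star_ideal \<Phi> \<Delta> I \<longleftrightarrow>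
     order_ideal (root_le \<Delta>) (positive_roots \<Phi> \<Delta>) I \<and>
     (\<exists>\<alpha>1\<in>\<Delta>. \<exists>\<alpha>2\<in>\<Delta>. \<exists>\<alpha>3\<in>\<Delta>. \<exists>\<alpha>4\<in>\<Delta>. distinct [\<alpha>1, \<alpha>2, \<alpha>3, \<alpha>4] \<and>
        {\<alpha>1 + \<alpha>2 + \<alpha>3, \<alpha>1 + \<alpha>2 + \<alpha>4, \<alpha>2 + \<alpha>3 + \<alpha>4} \<subseteq> \<Phi> \<inter> I)"

section \<open>Supersolvability\<close>

definition closure_in :: "'a::euclidean_space set \<Rightarrow> 'a set \<Rightarrow> 'a set" where
  "closure_in A S = A \<inter> span S"

text \<open>The rank of a set of vectors is \<open>dim\<close>, the dimension of its span.\<close>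

definition k_flat :: "nat \<Rightarrow> 'a::euclidean_space set \<Rightarrow> 'a set \<Rightarrow> bool" where
  "k_flat k A S \<longleftrightarrow> S \<subseteq> A \<and> closure_in A S = S \<and> dim S = k"

definition supersolvable :: "'a::euclidean_space set \<Rightarrow> bool" where
  "supersolvable A \<longleftrightarrow>
     (\<exists>B :: nat \<Rightarrow> 'a set.
        disjoint_family_on B {1..dim A} \<and> (\<forall>i\<in>{1..dim A}. B i \<noteq> {}) \<and>
        (\<Union>i\<in>{1..dim A}. B i) = A \<and>
        (\<forall>i\<in>{1..dim A}. let A\<^sub>i = (\<Union>j\<in>{1..i}. B j) in
           dim A\<^sub>i = i \<and> \<not> (\<exists>S. k_flat 2 A\<^sub>i S \<and> S \<subseteq> B i)))"

end

theory Submission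
  imports Defs
begin

text \<open>
  In a simply laced system all roots with a common simple root in their supports have the same
  length, so lowering a root of a non-star ideal \<open>I\<close> one simple root at a time shows that its
  coefficients are at most 1: a coefficient 2 would first appear at a branch node all of whose three
  neighbours are present, that is, above a star. Finite type forces each component of the Dynkin
  diagram to have at most one branch node \<open>c\<close>. Since \<open>I\<close> is not a star ideal, some two
  neighbours \<open>q\<close>, \<open>r\<close> of \<open>c\<close> satisfy \<open>c + q + r \<notin> I\<close>; walking from \<open>c\<close> through \<open>q\<close> to a leaf \<open>v\<close>,
  the roots of \<open>I\<close> above \<open>v\<close> meet no branching and form a chain. Differences of elements of such
  a chain are roots below it, so peeling off the chain gives both a chain peeling and a supersolvable
  partition.

  Conversely, each of the four simple roots of a star lies below two of the three incomparable
  roots of height 3, so none of them can ever be peeled off. Two orthogonal roots never lie in one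
  block of a supersolvable partition, because their plane contains no further root of \<open>I\<close>. The ten
  roots of height at most 3 of a star fall into three sets of pairwise orthogonal roots, hence all
  but at most one element of each set lie in the span of the earlier blocks. Applied to the block that
  completes the star, this puts the whole star into the span of the earlier blocks.
\<close>

section \<open>Auxiliary inequalities\<close>

lemma finite_obtains_max:
  fixes f :: "'b \<Rightarrow> real"
  assumes "finite S" "S \<noteq> {}"
  obtains x where "x \<in> S" "\<And>y. y \<in> S \<Longrightarrow> f y \<le> f x"
proof -
  have "Max (f ` S) \<in> f ` S" using assms by simp
  then obtain x where "x \<in> S" "f x = Max (f ` S)" by auto
  moreover have "f y \<le> Max (f ` S)" if "y \<in> S" for y using that assms by simp
  ultimately show ?thesis using that by metis
qed

lemma finite_obtains_min:
  fixes f :: "'b \<Rightarrow> real"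
  assumes "finite S" "S \<noteq> {}"
  obtains x where "x \<in> S" "\<And>y. y \<in> S \<Longrightarrow> f x \<le> f y"
  using finite_obtains_max[OF assms, of "\<lambda>x. - f x"] by auto

lemma Ints_pos_ge_1: "x \<in> \<int> \<Longrightarrow> 0 < x \<Longrightarrow> 1 \<le> (x::real)"
  by (elim Ints_cases) auto

lemma Ints_mult_le_1:
  fixes x y :: real
  assumes "x \<in> \<int>" "y \<in> \<int>" "x > 0" "y > 0" "x * y \<le> 1"
  shows "x = 1" "y = 1"
proof -
  have 1: "1 \<le> x" "1 \<le> y" using assms Ints_pos_ge_1 by auto
  have "x * 1 \<le> x * y" "1 * y \<le> x * y" using 1 by (intro mult_mono; simp)+
  then show "x = 1" "y = 1" using 1 assms(5) by linarith+
qed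

lemma sum_in_Nats: "(\<And>x. x \<in> A \<Longrightarrow> f x \<in> \<nat>) \<Longrightarrow> sum f A \<in> \<nat>"
  by (induction A rule: infinite_finite_induct) auto

lemma sum_le_two_terms:
  fixes f :: "'b \<Rightarrow> real"
  assumes "finite S" "a \<in> S" "b \<in> S" "a \<noteq> b" "\<And>x. x \<in> S \<Longrightarrow> f x \<le> 0"
  shows "sum f S \<le> f a + f b"
proof -
  have "sum f S = f a + (f b + sum f (S - {a} - {b}))"
    using assms by (simp add: sum.remove)
  moreover have "sum f (S - {a} - {b}) \<le> 0" using assms by (intro sum_nonpos) auto
  ultimately show ?thesis by simp
qed

lemma sum_le_one_term:
  fixes f :: "'b \<Rightarrow> real"
  assumes "finite S" "a \<in> S" "\<And>x. x \<in> S \<Longrightarrow> x \<noteq> a \<Longrightarrow> f x \<le> 0"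
  shows "sum f S \<le> f a"
proof -
  have "sum f S = f a + sum f (S - {a})" using assms by (simp add: sum.remove)
  moreover have "sum f (S - {a}) \<le> 0" using assms by (intro sum_nonpos) auto
  ultimately show ?thesis by simp
qed

section \<open>Roots and coefficients in the simply laced case\<close>

locale simply_laced_root_system =
  fixes \<Phi> \<Delta> :: "'a::euclidean_space set"
  assumes root_system: "root_system \<Phi>"
    and simple_roots: "simple_roots \<Phi> \<Delta>"
    and simply_laced: "simply_laced \<Delta>"
begin

abbreviation cf :: "'a \<Rightarrow> 'a \<Rightarrow> real" where
  "cf \<equiv> representation \<Delta>"

abbreviation Pos :: "'a set" where
  "Pos \<equiv> positive_roots \<Phi> \<Delta>"

abbreviation le :: "'a \<Rightarrow> 'a \<Rightarrow> bool" where
  "le \<equiv> root_le \<Delta>"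

definition ht :: "'a \<Rightarrow> real" where
  "ht x = (\<Sum>\<alpha>\<in>\<Delta>. cf x \<alpha>)"

section \<open>Coefficients, positivity and height\<close>

lemma finite_roots: "finite \<Phi>" and nonzero_root: "\<alpha> \<in> \<Phi> \<Longrightarrow> \<alpha> \<noteq> 0"
  and reflect_root: "\<alpha> \<in> \<Phi> \<Longrightarrow> \<beta> \<in> \<Phi> \<Longrightarrow> \<beta> - cartan_int \<beta> \<alpha> *\<^sub>R \<alpha> \<in> \<Phi>"
  and cartan_Ints: "\<alpha> \<in> \<Phi> \<Longrightarrow> \<beta> \<in> \<Phi> \<Longrightarrow> cartan_int \<beta> \<alpha> \<in> \<int>"
  and reduced: "\<alpha> \<in> \<Phi> \<Longrightarrow> c *\<^sub>R \<alpha> \<in> \<Phi> \<Longrightarrow> c = 1 \<or> c = -1"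
  using root_system unfolding root_system_def by auto

lemma simple_root: "\<alpha> \<in> \<Delta> \<Longrightarrow> \<alpha> \<in> \<Phi>"
  and indep: "independent \<Delta>"
  and pos_or_neg: "\<gamma> \<in> \<Phi> \<Longrightarrow> \<gamma> \<in> Pos \<or> - \<gamma> \<in> Pos"
  using simple_roots unfolding simple_roots_def by auto

lemma finite_simple: "finite \<Delta>"
  using simple_root finite_roots finite_subset[of \<Delta> \<Phi>] by auto

lemma pos_root: "\<gamma> \<in> Pos \<Longrightarrow> \<gamma> \<in> \<Phi>"
  by (auto simp: positive_roots_def)

lemma finite_Pos: "finite Pos"
  using finite_roots pos_root finite_subset[of Pos \<Phi>] by auto

lemma pos_span: "\<gamma> \<in> Pos \<Longrightarrow> \<gamma> \<in> span \<Delta>"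
  by (auto simp: positive_roots_def span_sum span_scale span_base)

lemma root_span: "\<gamma> \<in> \<Phi> \<Longrightarrow> \<gamma> \<in> span \<Delta>"
  using pos_or_neg pos_span span_neg by fastforce

lemma simple_span: "\<alpha> \<in> \<Delta> \<Longrightarrow> \<alpha> \<in> span \<Delta>"
  by (rule span_base)

lemma cf_add: "x \<in> span \<Delta> \<Longrightarrow> y \<in> span \<Delta> \<Longrightarrow> cf (x + y) a = cf x a + cf y a"
  and cf_diff: "x \<in> span \<Delta> \<Longrightarrow> y \<in> span \<Delta> \<Longrightarrow> cf (x - y) a = cf x a - cf y a"
  and cf_scale: "x \<in> span \<Delta> \<Longrightarrow> cf (c *\<^sub>R x) a = c * cf x a"
  and cf_neg: "x \<in> span \<Delta> \<Longrightarrow> cf (- x) a = - cf x a"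
  and cf_simple: "\<alpha> \<in> \<Delta> \<Longrightarrow> cf \<alpha> a = (if a = \<alpha> then 1 else 0)"
  and cf_zero: "cf 0 a = 0"
  using indep
  by (simp_all add: representation_add representation_diff representation_scale
      representation_neg representation_basis representation_zero)

lemmas cf_simps = cf_add cf_diff cf_scale cf_neg cf_simple cf_zero simple_span root_span pos_span
  span_add span_diff span_scale span_neg

lemma cf_sum: "x \<in> span \<Delta> \<Longrightarrow> (\<Sum>\<alpha>\<in>\<Delta>. cf x \<alpha> *\<^sub>R \<alpha>) = x"
  using sum_representation_eq[OF indep _ finite_simple subset_refl] by auto

lemma cf_eqI: "x \<in> span \<Delta> \<Longrightarrow> y \<in> span \<Delta> \<Longrightarrow> (\<And>a. a \<in> \<Delta> \<Longrightarrow> cf x a = cf y a) \<Longrightarrow> x = y"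
  using cf_sum[of x] cf_sum[of y] by (metis (no_types, lifting) sum.cong)

lemma pos_cf_Nats: assumes "\<gamma> \<in> Pos" shows "cf \<gamma> a \<in> \<nat>"
proof -
  from assms obtain c :: "'a \<Rightarrow> nat" where c: "\<gamma> = (\<Sum>\<alpha>\<in>\<Delta>. real (c \<alpha>) *\<^sub>R \<alpha>)"
    by (auto simp: positive_roots_def)
  have "cf \<gamma> a = (\<Sum>\<alpha>\<in>\<Delta>. cf (real (c \<alpha>) *\<^sub>R \<alpha>) a)"
    unfolding c using indep by (subst representation_sum) (auto simp: span_scale simple_span)
  also have "\<dots> = (\<Sum>\<alpha>\<in>\<Delta>. if \<alpha> = a then real (c \<alpha>) else 0)"
    by (intro sum.cong) (auto simp: cf_simps)
  also have "\<dots> \<in> \<nat>" using finite_simple by (simp add: sum.delta)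
  finally show ?thesis .
qed

lemma pos_cf_ge_0: "\<gamma> \<in> Pos \<Longrightarrow> 0 \<le> cf \<gamma> a"
  using pos_cf_Nats[of \<gamma> a] by (auto elim!: Nats_cases)

lemma pos_cf_ge_1: "\<gamma> \<in> Pos \<Longrightarrow> 0 < cf \<gamma> a \<Longrightarrow> 1 \<le> cf \<gamma> a"
  using pos_cf_Nats[of \<gamma> a] by (auto elim!: Nats_cases)

lemma pos_cf_ge_2: "\<gamma> \<in> Pos \<Longrightarrow> 1 < cf \<gamma> a \<Longrightarrow> 2 \<le> cf \<gamma> a"
  using pos_cf_Nats[of \<gamma> a] by (auto elim!: Nats_cases)

text \<open>The coefficients of a root all have one sign, so a single positive one decides. Roots
  constructed below are usually shown positive through a support node that the construction leaves
  intact.\<close>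

lemma posI_cf: assumes "\<gamma> \<in> \<Phi>" "0 < cf \<gamma> a" shows "\<gamma> \<in> Pos"
proof (rule ccontr)
  assume "\<gamma> \<notin> Pos"
  then have "- \<gamma> \<in> Pos" using pos_or_neg assms by auto
  from pos_cf_ge_0[OF this, of a] assms show False by (simp add: cf_simps)
qed

lemma pos_obtain_cf: assumes "\<gamma> \<in> Pos" obtains a where "a \<in> \<Delta>" "0 < cf \<gamma> a"
proof -
  have "\<exists>a\<in>\<Delta>. 0 < cf \<gamma> a"
  proof (rule ccontr)
    assume "\<not> ?thesis"
    then have "cf \<gamma> a = 0" if "a \<in> \<Delta>" for a using pos_cf_ge_0[OF assms, of a] that by force
    then have "\<gamma> = 0" using cf_sum[OF pos_span[OF assms]] by simp
    then show False using nonzero_root pos_root assms by auto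
  qed
  with that show ?thesis by auto
qed

lemma posI_nonneg: assumes "\<gamma> \<in> \<Phi>" "\<And>a. a \<in> \<Delta> \<Longrightarrow> 0 \<le> cf \<gamma> a" shows "\<gamma> \<in> Pos"
proof (rule ccontr)
  assume "\<gamma> \<notin> Pos"
  then have n: "- \<gamma> \<in> Pos" using pos_or_neg assms by auto
  then obtain a where "a \<in> \<Delta>" "0 < cf (- \<gamma>) a" by (rule pos_obtain_cf)
  then show False using assms(1) assms(2)[of a] by (simp add: cf_simps)
qed

lemma pos_minus: "\<gamma> \<in> Pos \<Longrightarrow> - \<gamma> \<notin> Pos"
  using pos_obtain_cf[of \<gamma>] pos_cf_ge_0[of "- \<gamma>"] by (metis cf_neg neg_0_le_iff_le not_le pos_span)

lemma simple_pos: "\<alpha> \<in> \<Delta> \<Longrightarrow> \<alpha> \<in> Pos"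
  by (rule posI_nonneg) (auto simp: simple_root cf_simple)

lemma pos_nonzero: "\<gamma> \<in> Pos \<Longrightarrow> 0 < \<gamma> \<bullet> \<gamma>"
  using nonzero_root pos_root by auto

lemma ht_add: "x \<in> span \<Delta> \<Longrightarrow> y \<in> span \<Delta> \<Longrightarrow> ht (x + y) = ht x + ht y"
  and ht_diff: "x \<in> span \<Delta> \<Longrightarrow> y \<in> span \<Delta> \<Longrightarrow> ht (x - y) = ht x - ht y"
  and ht_scale: "x \<in> span \<Delta> \<Longrightarrow> ht (c *\<^sub>R x) = c * ht x"
  by (simp_all add: ht_def cf_simps sum.distrib sum_subtractf sum_distrib_left)

lemma ht_simple: "\<alpha> \<in> \<Delta> \<Longrightarrow> ht \<alpha> = 1"
  using finite_simple by (simp add: ht_def cf_simple)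

lemma ht_Nats: "\<gamma> \<in> Pos \<Longrightarrow> ht \<gamma> \<in> \<nat>"
  unfolding ht_def by (intro sum_in_Nats pos_cf_Nats)

text \<open>Heights are real because coefficients are. On positive roots they are natural numbers,
  so descent terminates; the floor only moves the measure to \<open>nat\<close>.\<close>

lemma pos_induct [consumes 1, case_names less]:
  assumes "\<gamma> \<in> Pos"
    and step: "\<And>\<gamma>. \<gamma> \<in> Pos \<Longrightarrow> (\<And>\<delta>. \<delta> \<in> Pos \<Longrightarrow> ht \<delta> < ht \<gamma> \<Longrightarrow> Q \<delta>) \<Longrightarrow> Q \<gamma>"
  shows "Q \<gamma>"
  using assms(1)
proof (induction "nat \<lfloor>ht \<gamma>\<rfloor>" arbitrary: \<gamma> rule: less_induct)
  case less
  show ?case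
  proof (rule step[OF less.prems])
    fix \<delta> assume d: "\<delta> \<in> Pos" "ht \<delta> < ht \<gamma>"
    have "nat \<lfloor>ht \<delta>\<rfloor> < nat \<lfloor>ht \<gamma>\<rfloor>"
      using d ht_Nats[OF d(1)] ht_Nats[OF less.prems] by (auto elim!: Nats_cases)
    then show "Q \<delta>" using less.hyps d by blast
  qed
qed

text \<open>Otherwise both Cartan integers are positive with product at most 1, hence both are 1,
  and reflection makes \<open>\<alpha> - \<beta>\<close> a root with coefficients of both
  signs.\<close>

lemma simple_inner_nonpos:
  assumes "\<alpha> \<in> \<Delta>" "\<beta> \<in> \<Delta>" "\<alpha> \<noteq> \<beta>" shows "\<alpha> \<bullet> \<beta> \<le> 0"
proof (rule ccontr)
  assume n: "\<not> \<alpha> \<bullet> \<beta> \<le> 0"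
  have p: "0 < \<alpha> \<bullet> \<alpha>" "0 < \<beta> \<bullet> \<beta>" using assms simple_pos pos_nonzero by auto
  have c: "0 < cartan_int \<alpha> \<beta>" "0 < cartan_int \<beta> \<alpha>"
    using n p unfolding cartan_int_def by (auto simp: inner_commute)
  have "cartan_int \<alpha> \<beta> * cartan_int \<beta> \<alpha> \<le> 1"
    using simply_laced assms unfolding simply_laced_def dynkin_bonds_def by auto
  then have "cartan_int \<alpha> \<beta> = 1"
    using Ints_mult_le_1 c cartan_Ints simple_root assms by meson
  then have r: "\<alpha> - \<beta> \<in> \<Phi>" using reflect_root[of \<beta> \<alpha>] assms simple_root by simp
  have "\<alpha> - \<beta> \<in> Pos" by (rule posI_cf[OF r, of \<alpha>]) (use assms in \<open>auto simp: cf_simps\<close>)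
  from pos_cf_ge_0[OF this, of \<beta>] assms show False by (simp add: cf_simps)
qed

text \<open>Both Cartan integers are negative with product at most 1, so both are -1: the two roots
  meet at 120 degrees.\<close>

lemma adjacent_norm:
  assumes "\<alpha> \<in> \<Delta>" "\<beta> \<in> \<Delta>" "\<alpha> \<bullet> \<beta> < 0"
  shows "\<alpha> \<bullet> \<alpha> = \<beta> \<bullet> \<beta>" "2 * (\<alpha> \<bullet> \<beta>) = - (\<beta> \<bullet> \<beta>)"
proof -
  have p: "0 < \<alpha> \<bullet> \<alpha>" "0 < \<beta> \<bullet> \<beta>" using assms simple_pos pos_nonzero by auto
  have ne: "\<alpha> \<noteq> \<beta>" using assms(3) p(1) by (metis less_asym)
  have c: "0 < - cartan_int \<alpha> \<beta>" "0 < - cartan_int \<beta> \<alpha>"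
    using assms p unfolding cartan_int_def by (auto simp: inner_commute divide_neg_pos)
  have "(- cartan_int \<alpha> \<beta>) * (- cartan_int \<beta> \<alpha>) \<le> 1"
    using simply_laced assms ne unfolding simply_laced_def dynkin_bonds_def by auto
  moreover have "- cartan_int \<alpha> \<beta> \<in> \<int>" "- cartan_int \<beta> \<alpha> \<in> \<int>"
    using cartan_Ints simple_root assms by auto
  ultimately have "- cartan_int \<alpha> \<beta> = 1" "- cartan_int \<beta> \<alpha> = 1"
    using Ints_mult_le_1 c by blast+
  then have "2 * (\<alpha> \<bullet> \<beta>) = - (\<beta> \<bullet> \<beta>)" "2 * (\<beta> \<bullet> \<alpha>) = - (\<alpha> \<bullet> \<alpha>)"
    using p unfolding cartan_int_def by (auto simp: field_simps)
  then show "\<alpha> \<bullet> \<alpha> = \<beta> \<bullet> \<beta>" "2 * (\<alpha> \<bullet> \<beta>) = - (\<beta> \<bullet> \<beta>)" by (auto simp: inner_commute)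
qed

section \<open>Inner products of positive roots with simple roots\<close>

lemma inner_cf_left: "x \<in> span \<Delta> \<Longrightarrow> x \<bullet> y = (\<Sum>\<alpha>\<in>\<Delta>. cf x \<alpha> * (\<alpha> \<bullet> y))"
  by (subst (1) cf_sum[symmetric]) (auto simp: inner_sum_left)

lemma inner_cf_remove:
  "x \<in> span \<Delta> \<Longrightarrow> a \<in> \<Delta> \<Longrightarrow> x \<bullet> y = cf x a * (a \<bullet> y) + (\<Sum>\<alpha>\<in>\<Delta>-{a}. cf x \<alpha> * (\<alpha> \<bullet> y))"
  using inner_cf_left[of x y] finite_simple by (simp add: sum.remove)

lemma norm_eq_sum: "x \<in> span \<Delta> \<Longrightarrow> x \<bullet> x = (\<Sum>\<alpha>\<in>\<Delta>. cf x \<alpha> * (x \<bullet> \<alpha>))"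
  using inner_cf_left[of x x] by (simp add: inner_commute)

lemma off_support_term_nonpos:
  "\<gamma> \<in> Pos \<Longrightarrow> \<alpha> \<in> \<Delta> \<Longrightarrow> \<beta> \<in> \<Delta> \<Longrightarrow> \<beta> \<noteq> \<alpha> \<Longrightarrow> cf \<gamma> \<beta> * (\<beta> \<bullet> \<alpha>) \<le> 0"
  using simple_inner_nonpos pos_cf_ge_0 by (simp add: mult_nonneg_nonpos)

lemma off_support_inner_nonpos:
  assumes "\<gamma> \<in> Pos" "\<alpha> \<in> \<Delta>" "cf \<gamma> \<alpha> = 0" shows "\<gamma> \<bullet> \<alpha> \<le> 0"
  unfolding inner_cf_left[OF pos_span[OF assms(1)], of \<alpha>]
  using off_support_term_nonpos[OF assms(1,2)] assms(3)
  by (intro sum_nonpos) (metis mult_zero_left order_refl)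

lemma inner_neg_obtains_adjacent:
  assumes "\<gamma> \<in> Pos" "\<alpha> \<in> \<Delta>" "\<gamma> \<bullet> \<alpha> < 0"
  obtains \<beta> where "\<beta> \<in> \<Delta>" "0 < cf \<gamma> \<beta>" "\<beta> \<bullet> \<alpha> < 0"
proof -
  have "\<exists>\<beta>\<in>\<Delta>. cf \<gamma> \<beta> * (\<beta> \<bullet> \<alpha>) < 0"
  proof (rule ccontr)
    assume "\<not> ?thesis"
    then have "0 \<le> \<gamma> \<bullet> \<alpha>" using inner_cf_left[OF pos_span[OF assms(1)], of \<alpha>]
      by (metis (no_types, lifting) not_le sum_nonneg)
    then show False using assms by simp
  qed
  then obtain \<beta> where "\<beta> \<in> \<Delta>" "cf \<gamma> \<beta> * (\<beta> \<bullet> \<alpha>) < 0" by auto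
  then show ?thesis using that pos_cf_ge_0[OF assms(1), of \<beta>]
    by (auto simp: mult_less_0_iff)
qed

text \<open>The positive norm of \<gamma> is the sum of the terms
  \<open>cf \<gamma> \<alpha> * (\<gamma> \<bullet> \<alpha>)\<close>. This supplies the simple root
  along which inductions on height descend.\<close>

lemma pos_obtain_inner_pos:
  assumes "\<gamma> \<in> Pos" obtains \<alpha> where "\<alpha> \<in> \<Delta>" "0 < \<gamma> \<bullet> \<alpha>" "0 < cf \<gamma> \<alpha>"
proof -
  have "\<exists>\<alpha>\<in>\<Delta>. 0 < cf \<gamma> \<alpha> * (\<gamma> \<bullet> \<alpha>)"
  proof (rule ccontr)
    assume "\<not> ?thesis"
    then have "\<gamma> \<bullet> \<gamma> \<le> 0" unfolding norm_eq_sum[OF pos_span[OF assms]]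
      by (intro sum_nonpos) force
    then show False using pos_nonzero[OF assms] by simp
  qed
  then show ?thesis using that pos_cf_ge_0[OF assms] by (metis zero_less_mult_pos zero_less_mult_iff less_le_not_le)
qed

lemma pos_multiple_simple:
  assumes "\<gamma> \<in> Pos" "\<alpha> \<in> \<Delta>" "\<And>\<beta>. \<beta> \<in> \<Delta> \<Longrightarrow> \<beta> \<noteq> \<alpha> \<Longrightarrow> cf \<gamma> \<beta> = 0"
  shows "\<gamma> = \<alpha>"
proof -
  have "\<gamma> = cf \<gamma> \<alpha> *\<^sub>R \<alpha>"
    by (rule cf_eqI) (use assms in \<open>auto simp: cf_simps\<close>)
  moreover from this have "cf \<gamma> \<alpha> = 1 \<or> cf \<gamma> \<alpha> = -1"
    using reduced[of \<alpha> "cf \<gamma> \<alpha>"] assms simple_root pos_root by auto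
  ultimately show ?thesis using pos_cf_ge_0[OF assms(1), of \<alpha>] by auto
qed

lemma pos_obtain_other:
  assumes "\<gamma> \<in> Pos" "\<alpha> \<in> \<Delta>" "\<gamma> \<noteq> \<alpha>"
  obtains \<beta> where "\<beta> \<in> \<Delta>" "\<beta> \<noteq> \<alpha>" "0 < cf \<gamma> \<beta>"
  using pos_multiple_simple[OF assms(1,2)] assms(3) pos_cf_ge_0[OF assms(1)] that
  by (metis less_eq_real_def)

text \<open>Induction on height. Reflecting in \<tau> keeps the length and lowers the height; the
  full reflection is used because its multiple \<open>c\<close> is not yet known to be 1.\<close>

lemma norm_support:
  assumes "\<gamma> \<in> Pos" "\<alpha> \<in> \<Delta>" "0 < cf \<gamma> \<alpha>" shows "\<alpha> \<bullet> \<alpha> = \<gamma> \<bullet> \<gamma>"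
  using assms
proof (induction \<gamma> arbitrary: \<alpha> rule: pos_induct)
  case (less \<gamma>)
  obtain \<tau> where t: "\<tau> \<in> \<Delta>" "0 < \<gamma> \<bullet> \<tau>" "0 < cf \<gamma> \<tau>" using pos_obtain_inner_pos less.hyps by blast
  show ?case
  proof (cases "\<gamma> = \<tau>")
    case True then show ?thesis using less t by (auto simp: cf_simple split: if_splits)
  next
    case False
    define c where "c = cartan_int \<gamma> \<tau>"
    have tp: "0 < \<tau> \<bullet> \<tau>" using t simple_pos pos_nonzero by auto
    then have cp: "0 < c" "c * (\<tau> \<bullet> \<tau>) = 2 * (\<gamma> \<bullet> \<tau>)" using t by (auto simp: c_def cartan_int_def)
    define \<delta> where "\<delta> = \<gamma> - c *\<^sub>R \<tau>"
    have dr: "\<delta> \<in> \<Phi>" using reflect_root t simple_root pos_root less.hyps by (simp add: \<delta>_def c_def)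
    have sp: "\<gamma> \<in> span \<Delta>" "\<tau> \<in> span \<Delta>" using less.hyps t pos_span simple_span by auto
    have cfd: "cf \<delta> a = cf \<gamma> a - c * (if a = \<tau> then 1 else 0)" for a
      using sp t by (simp add: \<delta>_def cf_simps)
    obtain \<beta> where b: "\<beta> \<in> \<Delta>" "\<beta> \<noteq> \<tau>" "0 < cf \<gamma> \<beta>" using pos_obtain_other[OF less.hyps t(1) False] .
    have dp: "\<delta> \<in> Pos" by (rule posI_cf[OF dr, of \<beta>]) (use b cfd in auto)
    have "ht \<delta> < ht \<gamma>" using sp t cp by (simp add: \<delta>_def ht_diff ht_scale span_scale ht_simple)
    note IH = less.IH[OF dp this]
    have "\<delta> \<bullet> \<delta> = \<gamma> \<bullet> \<gamma> - 2 * c * (\<gamma> \<bullet> \<tau>) + c * (c * (\<tau> \<bullet> \<tau>))"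
      by (simp add: \<delta>_def algebra_simps inner_commute)
    then have nd: "\<delta> \<bullet> \<delta> = \<gamma> \<bullet> \<gamma>" using cp by simp
    show ?thesis
    proof (cases "0 < cf \<delta> \<alpha>")
      case True then show ?thesis using IH less nd by auto
    next
      case False
      \<comment> \<open>Only \<tau> can have left the support. Reflection has made
        \<open>\<delta> \<bullet> \<tau>\<close> negative, so \<tau> has a neighbour in the support
        of \<delta>, and neighbours have equal length.\<close>
      then have at: "\<alpha> = \<tau>" using cfd[of \<alpha>] less by (auto split: if_splits)
      have "\<delta> \<bullet> \<tau> = \<gamma> \<bullet> \<tau> - c * (\<tau> \<bullet> \<tau>)" by (simp add: \<delta>_def algebra_simps)
      then have "\<delta> \<bullet> \<tau> < 0" using cp t by simp
      then obtain \<beta> where "\<beta> \<in> \<Delta>" "0 < cf \<delta> \<beta>" "\<beta> \<bullet> \<tau> < 0"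
        using inner_neg_obtains_adjacent dp t by blast
      then show ?thesis using IH nd at adjacent_norm t by metis
    qed
  qed
qed

text \<open>Strict Cauchy-Schwarz, read off from the norms of \<open>x - y\<close> and
  \<open>x + y\<close>, confines the Cartan integer to -1, 0, 1. Reflecting in \<open>y\<close> then
  gives the sum or the difference.\<close>

lemma same_norm_inner:
  assumes "x \<in> \<Phi>" "y \<in> \<Phi>" "x \<bullet> x = y \<bullet> y" "x \<noteq> y" "x \<noteq> - y"
  shows "0 < x \<bullet> y \<Longrightarrow> 2 * (x \<bullet> y) = y \<bullet> y" "0 < x \<bullet> y \<Longrightarrow> x - y \<in> \<Phi>"
    and "x \<bullet> y < 0 \<Longrightarrow> 2 * (x \<bullet> y) = - (y \<bullet> y)" "x \<bullet> y < 0 \<Longrightarrow> x + y \<in> \<Phi>"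
proof -
  have N: "0 < y \<bullet> y" using nonzero_root assms by auto
  have c: "cartan_int x y * (y \<bullet> y) = 2 * (x \<bullet> y)" using N by (simp add: cartan_int_def)
  have "0 < (x - y) \<bullet> (x - y)" "0 < (x + y) \<bullet> (x + y)" using assms by (auto simp: eq_neg_iff_add_eq_0)
  then have "x \<bullet> y < y \<bullet> y" "- (y \<bullet> y) < x \<bullet> y"
    using assms(3) by (auto simp: algebra_simps inner_commute)
  then have "cartan_int x y * (y \<bullet> y) < 2 * (y \<bullet> y)" "-2 * (y \<bullet> y) < cartan_int x y * (y \<bullet> y)"
    using c by auto
  then have b: "cartan_int x y < 2" "-2 < cartan_int x y"
    using N by (metis mult_less_cancel_right_pos)+
  have I: "cartan_int x y \<in> \<int>" using cartan_Ints assms by auto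
  have 1: "cartan_int x y = 1" if "0 < x \<bullet> y"
  proof -
    have "0 < cartan_int x y" using that c N by (simp add: cartan_int_def)
    with I b show ?thesis by (elim Ints_cases) auto
  qed
  have 2: "cartan_int x y = -1" if "x \<bullet> y < 0"
  proof -
    have "0 > cartan_int x y" using that c N by (simp add: cartan_int_def divide_neg_pos)
    moreover obtain z :: int where "cartan_int x y = z" using I by (elim Ints_cases)
    moreover from calculation b(2) have "z < 0" "-2 < z" by linarith+
    ultimately show ?thesis by simp
  qed
  show "0 < x \<bullet> y \<Longrightarrow> 2 * (x \<bullet> y) = y \<bullet> y" "x \<bullet> y < 0 \<Longrightarrow> 2 * (x \<bullet> y) = - (y \<bullet> y)"
    using 1 2 c by auto
  show "0 < x \<bullet> y \<Longrightarrow> x - y \<in> \<Phi>" "x \<bullet> y < 0 \<Longrightarrow> x + y \<in> \<Phi>"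
    using 1 2 reflect_root[of y x] assms by auto
qed

lemma inner_pos_simple:
  assumes "\<gamma> \<in> Pos" "\<alpha> \<in> \<Delta>" "0 < \<gamma> \<bullet> \<alpha>" "\<gamma> \<noteq> \<alpha>"
  shows "\<alpha> \<bullet> \<alpha> = \<gamma> \<bullet> \<gamma>" "2 * (\<gamma> \<bullet> \<alpha>) = \<gamma> \<bullet> \<gamma>" "\<gamma> - \<alpha> \<in> Pos" "0 < cf \<gamma> \<alpha>"
proof -
  show s: "0 < cf \<gamma> \<alpha>" using off_support_inner_nonpos[OF assms(1,2)] assms pos_cf_ge_0[OF assms(1), of \<alpha>] by linarith
  show n: "\<alpha> \<bullet> \<alpha> = \<gamma> \<bullet> \<gamma>" using norm_support assms s by auto
  have "\<gamma> \<noteq> - \<alpha>" using assms simple_pos pos_minus by auto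
  note R = same_norm_inner[OF pos_root[OF assms(1)] simple_root[OF assms(2)] n[symmetric] assms(4) this]
  show "2 * (\<gamma> \<bullet> \<alpha>) = \<gamma> \<bullet> \<gamma>" using R n assms by auto
  obtain \<beta> where "\<beta> \<in> \<Delta>" "\<beta> \<noteq> \<alpha>" "0 < cf \<gamma> \<beta>" using pos_obtain_other[OF assms(1,2,4)] .
  then show "\<gamma> - \<alpha> \<in> Pos" using R assms by (intro posI_cf[of _ \<beta>]) (auto simp: cf_simps)
qed

lemma inner_neg_simple:
  assumes "\<gamma> \<in> Pos" "\<alpha> \<in> \<Delta>" "\<gamma> \<bullet> \<alpha> < 0"
  shows "\<alpha> \<bullet> \<alpha> = \<gamma> \<bullet> \<gamma>" "2 * (\<gamma> \<bullet> \<alpha>) = - (\<gamma> \<bullet> \<gamma>)" "\<gamma> + \<alpha> \<in> Pos"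
proof -
  obtain \<beta> where b: "\<beta> \<in> \<Delta>" "0 < cf \<gamma> \<beta>" "\<beta> \<bullet> \<alpha> < 0" using inner_neg_obtains_adjacent assms by blast
  show n: "\<alpha> \<bullet> \<alpha> = \<gamma> \<bullet> \<gamma>" using norm_support adjacent_norm b assms by metis
  have "\<gamma> \<noteq> - \<alpha>" "\<gamma> \<noteq> \<alpha>" using assms simple_pos pos_minus inner_ge_zero[of \<alpha>] by (auto simp: not_less[symmetric])
  note R = same_norm_inner[OF pos_root[OF assms(1)] simple_root[OF assms(2)] n[symmetric] this(2,1)]
  show "2 * (\<gamma> \<bullet> \<alpha>) = - (\<gamma> \<bullet> \<gamma>)" using R n assms by auto
  show "\<gamma> + \<alpha> \<in> Pos" using R assms b pos_cf_ge_0[OF simple_pos[OF assms(2)], of \<beta>]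
    by (intro posI_cf[of _ \<beta>]) (auto simp: cf_simps)
qed

lemma add_adjacent_simple:
  assumes "\<gamma> \<in> Pos" "y \<in> \<Delta>" "cf \<gamma> y = 0" "x \<in> \<Delta>" "0 < cf \<gamma> x" "x \<bullet> y < 0"
  shows "\<gamma> \<bullet> y < 0" "\<gamma> + y \<in> Pos"
proof -
  have "\<gamma> \<bullet> y \<le> cf \<gamma> x * (x \<bullet> y)"
    unfolding inner_cf_left[OF pos_span[OF assms(1)], of y]
    using off_support_term_nonpos[OF assms(1,2)] assms(3-)
    by (intro sum_le_one_term[OF finite_simple]) (auto, metis mult_zero_left order_refl)
  also have "\<dots> < 0" using assms by (simp add: mult_pos_neg)
  finally show "\<gamma> \<bullet> y < 0" .
  then show "\<gamma> + y \<in> Pos" using inner_neg_simple assms by auto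
qed

text \<open>Each attachment costs half of \<open>y \<bullet> y\<close>, and the Cartan integer
  allows only one such loss. As supports are connected, this expresses that the Dynkin diagram has
  no cycles.\<close>

lemma no_two_attachments:
  assumes "\<gamma> \<in> Pos" "y \<in> \<Delta>" "cf \<gamma> y = 0" "x \<in> \<Delta>" "0 < cf \<gamma> x" "x \<bullet> y < 0"
    "x' \<in> \<Delta>" "0 < cf \<gamma> x'" "x' \<bullet> y < 0"
  shows "x = x'"
proof (rule ccontr)
  assume ne: "x \<noteq> x'"
  have "\<gamma> \<bullet> y \<le> cf \<gamma> x * (x \<bullet> y) + cf \<gamma> x' * (x' \<bullet> y)"
    unfolding inner_cf_left[OF pos_span[OF assms(1)], of y]
    using off_support_term_nonpos[OF assms(1,2)] assms(3-) ne
    by (intro sum_le_two_terms[OF finite_simple]) (auto, metis mult_zero_left order_refl)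
  also have "cf \<gamma> x * (x \<bullet> y) \<le> 1 * (x \<bullet> y)"
    using pos_cf_ge_1[OF assms(1,5)] assms by (intro mult_right_mono_neg) auto
  also have "cf \<gamma> x' * (x' \<bullet> y) \<le> 1 * (x' \<bullet> y)"
    using pos_cf_ge_1[OF assms(1,8)] assms by (intro mult_right_mono_neg) auto
  finally have "2 * (\<gamma> \<bullet> y) \<le> 2 * (x \<bullet> y) + 2 * (x' \<bullet> y)" by simp
  moreover have "2 * (\<gamma> \<bullet> y) = - (y \<bullet> y)" using inner_neg_simple add_adjacent_simple assms by metis
  moreover have "2 * (x \<bullet> y) = - (y \<bullet> y)" "2 * (x' \<bullet> y) = - (y \<bullet> y)" using adjacent_norm assms by blast+
  ultimately show False using pos_nonzero[OF simple_pos[OF assms(2)]] by simp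
qed

section \<open>Supports and branch nodes\<close>

text \<open>Connectedness of supports, phrased as an edge across an arbitrary cut \<open>X\<close>
  of the support. This form avoids talking about paths.\<close>

lemma support_connected:
  assumes "\<gamma> \<in> Pos" "s \<in> \<Delta>" "s \<in> X" "0 < cf \<gamma> s" "t \<in> \<Delta>" "t \<notin> X" "0 < cf \<gamma> t"
  shows "\<exists>x y. x \<in> \<Delta> \<and> y \<in> \<Delta> \<and> x \<in> X \<and> y \<notin> X \<and> 0 < cf \<gamma> x \<and> 0 < cf \<gamma> y \<and> x \<bullet> y < 0"
  using assms
proof (induction \<gamma> arbitrary: s t X rule: pos_induct)
  case (less \<gamma>)
  \<comment> \<open>Here \<open>Y\<close> is the side of the cut that contains \<tau>. Subtracting
    \<tau> either leaves part of the support inside \<open>Y\<close>, and induction applies, or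
    empties that side; then \<open>\<delta> \<bullet> \<tau> < 0\<close> yields a neighbour of
    \<tau> across the cut.\<close>
  have *: "\<exists>x y. x \<in> \<Delta> \<and> y \<in> \<Delta> \<and> x \<in> Y \<and> y \<notin> Y \<and> 0 < cf \<gamma> x \<and> 0 < cf \<gamma> y \<and> x \<bullet> y < 0"
    if t: "\<tau> \<in> \<Delta>" "0 < \<gamma> \<bullet> \<tau>" "\<tau> \<in> Y" and s: "s \<in> \<Delta>" "s \<notin> Y" "0 < cf \<gamma> s" for \<tau> Y s
  proof -
    have ne: "\<gamma> \<noteq> \<tau>" using t s by (auto simp: cf_simple split: if_splits)
    note R = inner_pos_simple[OF less.hyps t(1,2) ne]
    define \<delta> where "\<delta> = \<gamma> - \<tau>"
    have dp: "\<delta> \<in> Pos" using R by (simp add: \<delta>_def)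
    have cfd: "cf \<delta> a = cf \<gamma> a - (if a = \<tau> then 1 else 0)" for a
      using less.hyps t by (simp add: \<delta>_def cf_simps)
    have hd: "ht \<delta> < ht \<gamma>" using less.hyps t by (simp add: \<delta>_def ht_diff cf_simps ht_simple)
    have sd: "0 < cf \<delta> s" using cfd s t by auto
    show ?thesis
    proof (cases "\<exists>x\<in>\<Delta>. x \<in> Y \<and> 0 < cf \<delta> x")
      case True
      then obtain x where "x \<in> \<Delta>" "x \<in> Y" "0 < cf \<delta> x" by auto
      from less.IH[OF dp hd this s(1,2) sd] obtain x y where
        "x \<in> \<Delta>" "y \<in> \<Delta>" "x \<in> Y" "y \<notin> Y" "0 < cf \<delta> x" "0 < cf \<delta> y" "x \<bullet> y < 0" by blast
      moreover from this have "0 < cf \<gamma> x" "0 < cf \<gamma> y" using cfd[of x] cfd[of y] by (auto split: if_splits)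
      ultimately show ?thesis by blast
    next
      case False
      have "2 * (\<delta> \<bullet> \<tau>) = - (\<gamma> \<bullet> \<gamma>)" using R by (simp add: \<delta>_def inner_diff_left)
      then have "\<delta> \<bullet> \<tau> < 0" using pos_nonzero[OF less.hyps] by linarith
      then obtain y where y: "y \<in> \<Delta>" "0 < cf \<delta> y" "y \<bullet> \<tau> < 0"
        using inner_neg_obtains_adjacent dp t by blast
      then have "y \<notin> Y" "0 < cf \<gamma> y" using False cfd[of y] by (auto split: if_splits)
      then show ?thesis using y t R by (metis inner_commute)
    qed
  qed
  obtain \<tau> where t: "\<tau> \<in> \<Delta>" "0 < \<gamma> \<bullet> \<tau>" using pos_obtain_inner_pos less.hyps by blast
  show ?case
  proof (cases "\<tau> \<in> X")
    case True
    then show ?thesis using *[OF t, of X t] less by blast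
  next
    case False
    then show ?thesis using *[OF t, of "- X" s] less by (metis Compl_iff inner_commute)
  qed
qed

text \<open>
  A root vanishing on \<open>Z\<close> that cannot be extended outside \<open>Z\<close> by a simple root has a connected
  component of \<open>\<Delta> - Z\<close> as its support.
\<close>

definition saturated_off :: "'a set \<Rightarrow> 'a \<Rightarrow> bool" where
  "saturated_off Z \<theta> \<longleftrightarrow> \<theta> \<in> Pos \<and> (\<forall>z\<in>Z. cf \<theta> z = 0) \<and>
     (\<forall>y\<in>\<Delta>-Z. cf \<theta> y = 0 \<longrightarrow> \<theta> + y \<notin> Pos)"

lemma saturated_off_exists:
  assumes "q \<in> \<Delta>" "q \<notin> Z"
  obtains \<theta> where "saturated_off Z \<theta>" "0 < cf \<theta> q"
proof -
  \<comment> \<open>An element of \<open>S\<close> of maximal height admits no extension outside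
    \<open>Z\<close>.\<close>
  define S where "S = {\<gamma> \<in> Pos. (\<forall>z\<in>Z. cf \<gamma> z = 0) \<and> 0 < cf \<gamma> q}"
  have "q \<in> S" using assms simple_pos by (auto simp: S_def cf_simple)
  moreover have "finite S" using finite_Pos by (simp add: S_def)
  ultimately obtain \<theta> where t: "\<theta> \<in> S" and max: "\<And>y. y \<in> S \<Longrightarrow> ht y \<le> ht \<theta>"
    using finite_obtains_max[of S ht] by (metis empty_iff)
  have "\<theta> + y \<notin> Pos" if "y \<in> \<Delta>" "y \<notin> Z" for y
  proof
    assume "\<theta> + y \<in> Pos"
    then have "\<theta> + y \<in> S" using t that by (auto simp: S_def cf_simps)
    from max[OF this] show False using t that by (auto simp: S_def ht_add cf_simps ht_simple)
  qed
  then show ?thesis using t that[of \<theta>] by (auto simp: S_def saturated_off_def)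
qed

text \<open>Otherwise an edge inside the support of \<gamma> leaves the support of \<theta>, and
  \<theta> could be extended by its outer end. So the support of \<theta> absorbs every root support
  off \<open>Z\<close> that it meets.\<close>

lemma saturated_off_support:
  assumes "saturated_off Z \<theta>" "\<gamma> \<in> Pos" "\<And>z. z \<in> Z \<Longrightarrow> cf \<gamma> z = 0"
    and "s \<in> \<Delta>" "0 < cf \<gamma> s" "0 < cf \<theta> s" "t \<in> \<Delta>" "0 < cf \<gamma> t"
  shows "0 < cf \<theta> t"
proof (rule ccontr)
  assume "\<not> 0 < cf \<theta> t"
  then obtain x y where xy: "x \<in> \<Delta>" "y \<in> \<Delta>" "0 < cf \<theta> x" "\<not> 0 < cf \<theta> y" "0 < cf \<gamma> y" "x \<bullet> y < 0"
    using support_connected[OF assms(2,4) _ assms(5), of "{x. 0 < cf \<theta> x}" t] assms by auto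
  have tp: "\<theta> \<in> Pos" using assms by (simp add: saturated_off_def)
  then have "cf \<theta> y = 0" using xy pos_cf_ge_0[of \<theta> y] by linarith
  moreover have "y \<notin> Z" using assms(3) xy by force
  ultimately show False using add_adjacent_simple(2)[OF tp xy(2)] xy assms(1) by (auto simp: saturated_off_def)
qed

text \<open>The argument against the affine diagram of type D4, with \<gamma> as centre:
  \<open>y\<close> below has norm at most 0 but a positive coefficient at \<open>a\<close>.\<close>

lemma attachments_le_3:
  assumes "\<gamma> \<in> Pos" "{a, b, c, d} \<subseteq> \<Delta>" "distinct [a, b, c, d]"
    and neg: "\<gamma> \<bullet> a < 0" "\<gamma> \<bullet> b < 0" "\<gamma> \<bullet> c < 0" "\<gamma> \<bullet> d < 0"
  shows False
proof -
  have D: "a \<in> \<Delta>" "b \<in> \<Delta>" "c \<in> \<Delta>" "d \<in> \<Delta>" using assms by auto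
  note R = inner_neg_simple[OF assms(1) D(1) neg(1)] inner_neg_simple[OF assms(1) D(2) neg(2)]
    inner_neg_simple[OF assms(1) D(3) neg(3)] inner_neg_simple[OF assms(1) D(4) neg(4)]
  have np: "a \<bullet> b \<le> 0" "a \<bullet> c \<le> 0" "a \<bullet> d \<le> 0" "b \<bullet> c \<le> 0" "b \<bullet> d \<le> 0" "c \<bullet> d \<le> 0"
    using simple_inner_nonpos D assms(3) by auto
  define y where "y = 2 *\<^sub>R \<gamma> + a + b + c + d"
  have "y \<bullet> y = 4 * (\<gamma> \<bullet> \<gamma>) + a \<bullet> a + b \<bullet> b + c \<bullet> c + d \<bullet> d
     + 4 * (\<gamma> \<bullet> a) + 4 * (\<gamma> \<bullet> b) + 4 * (\<gamma> \<bullet> c) + 4 * (\<gamma> \<bullet> d)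
     + 2 * (a \<bullet> b) + 2 * (a \<bullet> c) + 2 * (a \<bullet> d) + 2 * (b \<bullet> c) + 2 * (b \<bullet> d) + 2 * (c \<bullet> d)"
    by (simp add: y_def inner_add_left inner_add_right inner_commute)
  then have "y \<bullet> y \<le> 0" using R np by linarith
  then have "y = 0" by (metis inner_gt_zero_iff not_le)
  moreover have "0 < cf y a"
    using D assms(1,3) pos_cf_ge_0[OF assms(1), of a] by (auto simp: y_def cf_simps)
  ultimately show False by (simp add: cf_zero)
qed

lemma adjacent_ne: "x \<in> \<Delta> \<Longrightarrow> x \<bullet> y < 0 \<Longrightarrow> x \<noteq> y"
  by (metis inner_ge_zero not_le)

lemma simple_degree_le_3:
  assumes "c \<in> \<Delta>" "p \<in> \<Delta>" "q \<in> \<Delta>" "r \<in> \<Delta>" "distinct [p, q, r]"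
    "c \<bullet> p < 0" "c \<bullet> q < 0" "c \<bullet> r < 0" "s \<in> \<Delta>" "c \<bullet> s < 0"
  shows "s \<in> {p, q, r}"
  using attachments_le_3[OF simple_pos[OF assms(1)], of p q r s] assms by auto

text \<open>Starting from \<open>c \<bullet> c\<close>, which equals \<open>M \<bullet> M\<close>,
  every neighbour of \<open>c\<close> in the support lowers \<open>M \<bullet> c\<close> by at least
  half of that norm. Two of them would bring it down to 0, so at most one of the three lies in the
  support.\<close>

lemma branch_end:
  assumes M: "M \<in> Pos" "c \<in> \<Delta>" "cf M c = 1" "2 * (M \<bullet> c) = M \<bullet> M"
    and n: "n1 \<in> \<Delta>" "n2 \<in> \<Delta>" "n3 \<in> \<Delta>" "distinct [n1, n2, n3]"
      "n1 \<bullet> c < 0" "n2 \<bullet> c < 0" "n3 \<bullet> c < 0"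
  shows "\<exists>x y. x \<noteq> y \<and> x \<in> \<Delta> \<and> y \<in> \<Delta> \<and> cf M x = 0 \<and> cf M y = 0 \<and> x \<bullet> c < 0 \<and> y \<bullet> c < 0"
proof -
  have cn: "c \<bullet> c = M \<bullet> M" using norm_support M by auto
  have 1: "x = y" if xy: "x \<in> \<Delta>" "y \<in> \<Delta>" "x \<bullet> c < 0" "y \<bullet> c < 0" "0 < cf M x" "0 < cf M y" for x y
  proof (rule ccontr)
    assume ne: "x \<noteq> y"
    have xc: "x \<noteq> c" "y \<noteq> c" using adjacent_ne xy by auto
    have "(\<Sum>\<alpha>\<in>\<Delta>-{c}. cf M \<alpha> * (\<alpha> \<bullet> c)) \<le> cf M x * (x \<bullet> c) + cf M y * (y \<bullet> c)"
      using xy ne xc finite_simple off_support_term_nonpos[OF M(1,2)] by (intro sum_le_two_terms) auto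
    also have "cf M x * (x \<bullet> c) \<le> 1 * (x \<bullet> c)"
      using pos_cf_ge_1[OF M(1)] xy by (intro mult_right_mono_neg) auto
    also have "cf M y * (y \<bullet> c) \<le> 1 * (y \<bullet> c)"
      using pos_cf_ge_1[OF M(1)] xy by (intro mult_right_mono_neg) auto
    finally have "M \<bullet> c \<le> c \<bullet> c + (x \<bullet> c + y \<bullet> c)"
      using inner_cf_remove[OF pos_span[OF M(1)] M(2), of c] M by simp
    then show False using adjacent_norm(2)[OF xy(1) M(2) xy(3)] adjacent_norm(2)[OF xy(2) M(2) xy(4)]
        M(4) cn pos_nonzero[OF M(1)] by linarith
  qed
  have 0: "cf M x = 0 \<or> 0 < cf M x" for x using pos_cf_ge_0[OF M(1), of x] by linarith
  show ?thesis using 1[of n1 n2] 1[of n1 n3] 1[of n2 n3] 0[of n1] 0[of n2] 0[of n3] n by auto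
qed

text \<open>
  A minimal root supporting two branch nodes is the path between them; its four remaining
  neighbours would span, together with it, an affine diagram of type \<open>D\<close>.
\<close>

lemma branch_node_unique:
  assumes th: "\<theta> \<in> Pos" and c: "c \<in> \<Delta>" "0 < cf \<theta> c" "d \<in> \<Delta>" "0 < cf \<theta> d"
    and p: "p1 \<in> \<Delta>" "p2 \<in> \<Delta>" "p3 \<in> \<Delta>" "distinct [p1, p2, p3]"
      "p1 \<bullet> c < 0" "p2 \<bullet> c < 0" "p3 \<bullet> c < 0"
    and q: "q1 \<in> \<Delta>" "q2 \<in> \<Delta>" "q3 \<in> \<Delta>" "distinct [q1, q2, q3]"
      "q1 \<bullet> d < 0" "q2 \<bullet> d < 0" "q3 \<bullet> d < 0"
  shows "c = d"
proof (rule ccontr)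
  assume cd: "c \<noteq> d"
  define S where "S = {\<gamma> \<in> Pos. 0 < cf \<gamma> c \<and> 0 < cf \<gamma> d}"
  have "\<theta> \<in> S" "finite S" using th c finite_Pos by (auto simp: S_def)
  then obtain M where M: "M \<in> S" and min: "\<And>y. y \<in> S \<Longrightarrow> ht M \<le> ht y"
    using finite_obtains_min[of S ht] by (metis empty_iff)
  then have Mp: "M \<in> Pos" "0 < cf M c" "0 < cf M d" by (auto simp: S_def)
  have nm: "M - a \<notin> S" if "a \<in> \<Delta>" for a
    using min[of "M - a"] Mp that by (auto simp: ht_diff cf_simps ht_simple)
  have ne: "M \<noteq> a" if "a \<in> \<Delta>" for a
    using Mp cd that by (auto simp: cf_simple split: if_splits)
  have one: "cf M a = 1" if "0 < M \<bullet> a" "a \<in> \<Delta>" "a = c \<or> a = d" for a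
  proof (rule ccontr)
    note R = inner_pos_simple[OF Mp(1) that(2,1) ne[OF that(2)]]
    assume "cf M a \<noteq> 1"
    then have "1 < cf M a" using pos_cf_ge_1[OF Mp(1) R(4)] by simp
    then have "M - a \<in> S" using R Mp that cd by (auto simp: S_def cf_simps)
    then show False using nm that by auto
  qed
  \<comment> \<open>By minimality of \<open>M\<close>, each of \<open>c\<close> and \<open>d\<close>
    contributes at most half of \<open>M \<bullet> M\<close> to the expansion of the norm, and no
    other simple root contributes positively. Hence both contribute exactly half.\<close>
  have half: "cf M a * (M \<bullet> a) \<le> M \<bullet> M / 2" if "a \<in> \<Delta>" "a = c \<or> a = d" for a
  proof (cases "0 < M \<bullet> a")
    case True
    then show ?thesis using one[OF True that] inner_pos_simple[OF Mp(1) that(1) True ne[OF that(1)]] by simp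
  next
    case False
    then have "cf M a * (M \<bullet> a) \<le> 0" using pos_cf_ge_0[OF Mp(1)] by (simp add: mult_nonneg_nonpos)
    then show ?thesis using pos_nonzero[OF Mp(1)] by linarith
  qed
  have other: "cf M a * (M \<bullet> a) \<le> 0" if "a \<in> \<Delta>" "a \<noteq> c" "a \<noteq> d" for a
  proof (rule ccontr)
    assume n: "\<not> ?thesis"
    then have p: "0 < M \<bullet> a" using pos_cf_ge_0[OF Mp(1), of a] by (metis mult_nonneg_nonpos not_le)
    have "M - a \<in> S" using inner_pos_simple[OF Mp(1) that(1) p ne[OF that(1)]] Mp that
      by (auto simp: S_def cf_simps)
    then show False using nm that by auto
  qed
  have "M \<bullet> M = cf M c * (M \<bullet> c) + (cf M d * (M \<bullet> d) + (\<Sum>a\<in>\<Delta>-{c}-{d}. cf M a * (M \<bullet> a)))"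
    using norm_eq_sum[OF pos_span[OF Mp(1)]] c cd finite_simple
      sum.remove[of \<Delta> c "\<lambda>a. cf M a * (M \<bullet> a)"] sum.remove[of "\<Delta> - {c}" d "\<lambda>a. cf M a * (M \<bullet> a)"] by simp
  moreover have "(\<Sum>a\<in>\<Delta>-{c}-{d}. cf M a * (M \<bullet> a)) \<le> 0" using other by (intro sum_nonpos) auto
  ultimately have sum: "cf M c * (M \<bullet> c) = M \<bullet> M / 2" "cf M d * (M \<bullet> d) = M \<bullet> M / 2"
    using half[OF c(1)] half[OF c(3)] by (smt (verit) field_sum_of_halves)+
  have pc: "0 < M \<bullet> c" "0 < M \<bullet> d"
    using sum Mp pos_nonzero[OF Mp(1)] by (metis half_gt_zero zero_less_mult_pos)+
  have 1: "cf M c = 1" "cf M d = 1" using one pc c by auto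
  with sum have 2: "2 * (M \<bullet> c) = M \<bullet> M" "2 * (M \<bullet> d) = M \<bullet> M" by auto
  obtain x1 x2 where x: "x1 \<noteq> x2" "x1 \<in> \<Delta>" "x2 \<in> \<Delta>" "cf M x1 = 0" "cf M x2 = 0" "x1 \<bullet> c < 0" "x2 \<bullet> c < 0"
    using branch_end[OF Mp(1) c(1) 1(1) 2(1) p] by blast
  obtain y1 y2 where y: "y1 \<noteq> y2" "y1 \<in> \<Delta>" "y2 \<in> \<Delta>" "cf M y1 = 0" "cf M y2 = 0" "y1 \<bullet> d < 0" "y2 \<bullet> d < 0"
    using branch_end[OF Mp(1) c(3) 1(2) 2(2) q] by blast
  have neg: "M \<bullet> x1 < 0" "M \<bullet> x2 < 0" "M \<bullet> y1 < 0" "M \<bullet> y2 < 0"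
    using add_adjacent_simple(1)[OF Mp(1) _ _ c(1) Mp(2)] add_adjacent_simple(1)[OF Mp(1) _ _ c(3) Mp(3)] x y
    by (metis inner_commute)+
  \<comment> \<open>A common outer neighbour of \<open>c\<close> and \<open>d\<close> would be
    attached to two nodes of the support.\<close>
  have "x \<noteq> y" if "x \<in> \<Delta>" "cf M x = 0" "x \<bullet> c < 0" "y \<bullet> d < 0" for x y
    using no_two_attachments[OF Mp(1) that(1,2) c(1) Mp(2) _ c(3) Mp(3)] that cd by (metis inner_commute)
  then have "distinct [x1, x2, y1, y2]" using x y by auto
  then show False using attachments_le_3[OF Mp(1), of x1 x2 y1 y2] x y neg by auto
qed

lemma path3_pos:
  assumes "p \<in> \<Delta>" "c \<in> \<Delta>" "q \<in> \<Delta>" "p \<noteq> q" "p \<bullet> c < 0" "q \<bullet> c < 0"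
  shows "c + p \<in> Pos" "p + c + q \<in> Pos"
proof -
  have ne: "p \<noteq> c" "q \<noteq> c" using adjacent_ne assms by auto
  show 1: "c + p \<in> Pos"
    using add_adjacent_simple(2)[OF simple_pos[OF assms(2)] assms(1) _ assms(2)] assms ne
    by (simp add: cf_simple inner_commute)
  show "p + c + q \<in> Pos"
    using add_adjacent_simple(2)[OF 1 assms(3) _ assms(2)] assms ne
    by (simp add: cf_simps simple_pos inner_commute add.commute)
qed

text \<open>By \<open>norm_support\<close>, \<gamma>, \<open>b\<close> and their sum have the same
  length; expanding the norm of the sum gives the sign.\<close>

lemma add_simple_inner:
  assumes "\<gamma> \<in> Pos" "b \<in> \<Delta>" "\<gamma> + b \<in> Pos" shows "\<gamma> \<bullet> b < 0"
proof -
  obtain a where a: "a \<in> \<Delta>" "0 < cf \<gamma> a" using pos_obtain_cf assms by blast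
  have "0 < cf (\<gamma> + b) a" "0 < cf (\<gamma> + b) b"
    using a assms(1,2) pos_cf_ge_0[OF simple_pos[OF assms(2)], of a] pos_cf_ge_0[OF assms(1), of b]
    by (simp_all add: cf_add pos_span simple_span cf_simple[OF assms(2), of b])
  then have "a \<bullet> a = \<gamma> \<bullet> \<gamma>" "a \<bullet> a = (\<gamma> + b) \<bullet> (\<gamma> + b)" "b \<bullet> b = (\<gamma> + b) \<bullet> (\<gamma> + b)"
    using norm_support a assms by blast+
  moreover have "(\<gamma> + b) \<bullet> (\<gamma> + b) = \<gamma> \<bullet> \<gamma> + 2 * (\<gamma> \<bullet> b) + b \<bullet> b"
    by (simp add: inner_add_left inner_add_right inner_commute)
  ultimately show ?thesis using pos_nonzero[OF simple_pos[OF assms(2)]] by linarith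
qed

section \<open>The root order and heights\<close>

lemma simple_le_iff: "a \<in> \<Delta> \<Longrightarrow> \<gamma> \<in> Pos \<Longrightarrow> le a \<gamma> \<longleftrightarrow> 0 < cf \<gamma> a"
  using pos_cf_ge_0 pos_cf_ge_1 by (auto simp: root_le_def cf_simple)

lemma le_antisym: "x \<in> Pos \<Longrightarrow> y \<in> Pos \<Longrightarrow> le x y \<Longrightarrow> le y x \<Longrightarrow> x = y"
  by (rule cf_eqI) (force simp: root_le_def pos_span)+

lemma le_ht_eq: assumes "x \<in> Pos" "y \<in> Pos" "le x y" "ht y \<le> ht x" shows "x = y"
proof (rule cf_eqI)
  have "cf x a = cf y a" if "a \<in> \<Delta>" for a
  proof (rule ccontr)
    assume "\<not> ?thesis"
    then have "cf x a < cf y a" using assms(3) that by (force simp: root_le_def)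
    then have "ht x < ht y" unfolding ht_def using assms(3) that finite_simple
      by (intro sum_strict_mono_ex1) (auto simp: root_le_def)
    then show False using assms by simp
  qed
  then show "a \<in> \<Delta> \<Longrightarrow> cf x a = cf y a" for a .
qed (use assms in \<open>auto simp: cf_simps\<close>)

end

section \<open>Non-star ideals\<close>

locale root_ideal = simply_laced_root_system +
  fixes I :: "'a set"
  assumes ideal: "order_ideal le Pos I"
begin

text \<open>For simple \<open>v\<close> this is the part of \<open>I\<close> that lies above
  \<open>v\<close> in the root order. It becomes the last block whenever it is a chain.\<close>

definition above :: "'a \<Rightarrow> 'a set" where
  "above v = {\<gamma> \<in> I. 0 < cf \<gamma> v}"

lemma I_pos: "x \<in> I \<Longrightarrow> x \<in> Pos"
  using ideal by (auto simp: order_ideal_def)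

lemma finite_I: "finite I"
  using finite_Pos I_pos finite_subset[of I Pos] by auto

lemma I_down: "x \<in> I \<Longrightarrow> y \<in> Pos \<Longrightarrow> le y x \<Longrightarrow> y \<in> I"
  using ideal unfolding order_ideal_def by blast

lemma I_simple: "x \<in> I \<Longrightarrow> a \<in> \<Delta> \<Longrightarrow> 0 < cf x a \<Longrightarrow> a \<in> I"
  using I_down[of x a] simple_pos[of a] simple_le_iff[of a x] I_pos[of x] by simp

lemma I_diff: "x \<in> I \<Longrightarrow> y \<in> Pos \<Longrightarrow> x - y \<in> Pos \<Longrightarrow> x - y \<in> I"
  by (rule I_down, assumption+) (auto simp: root_le_def cf_simps I_pos pos_cf_ge_0)

lemma path3_in_I:
  assumes "\<gamma> \<in> I" "p \<in> \<Delta>" "c \<in> \<Delta>" "q \<in> \<Delta>" "p \<noteq> q" "p \<bullet> c < 0" "q \<bullet> c < 0"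
    "0 < cf \<gamma> p" "0 < cf \<gamma> c" "0 < cf \<gamma> q"
  shows "p + c + q \<in> I"
proof (rule I_down[OF assms(1) path3_pos(2)[OF assms(2-7)]])
  have "p \<noteq> c" "q \<noteq> c" using adjacent_ne assms by auto
  then show "le (p + c + q) \<gamma>"
    using assms pos_cf_ge_1[OF I_pos[OF assms(1)]] pos_cf_ge_0[OF I_pos[OF assms(1)]]
    by (auto simp: root_le_def cf_simps)
qed

end

locale nonstar_ideal = root_ideal +
  assumes nonstar: "\<not> star_ideal \<Phi> \<Delta> I"
begin

section \<open>Coefficients in a non-star ideal\<close>

lemma no_star:
  assumes "p \<in> \<Delta>" "c \<in> \<Delta>" "q \<in> \<Delta>" "r \<in> \<Delta>" "distinct [p, c, q, r]"
    "p + c + q \<in> I" "p + c + r \<in> I" "q + c + r \<in> I"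
  shows False
proof -
  have "c + q + r = q + c + r" by simp
  then have "{p + c + q, p + c + r, c + q + r} \<subseteq> \<Phi> \<inter> I"
    using assms(6-8) I_pos pos_root by (metis Int_iff empty_subsetI insert_subset)
  then show False using nonstar ideal assms(1-5) unfolding star_ideal_def by blast
qed

lemma cf_le_1: "\<gamma> \<in> I \<Longrightarrow> cf \<gamma> a \<le> 1"
proof -
  have "\<gamma> \<in> I \<longrightarrow> (\<forall>a. cf \<gamma> a \<le> 1)" if "\<gamma> \<in> Pos" for \<gamma>
    using that
  proof (induction \<gamma> rule: pos_induct)
    case (less \<gamma>)
    show ?case
    proof (intro impI allI)
      fix a assume gI: "\<gamma> \<in> I"
      obtain \<tau> where t: "\<tau> \<in> \<Delta>" "0 < \<gamma> \<bullet> \<tau>" using pos_obtain_inner_pos less.hyps by blast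
      show "cf \<gamma> a \<le> 1"
      proof (cases "\<gamma> = \<tau>")
        case True then show ?thesis using t by (simp add: cf_simple)
      next
        case False
        note R = inner_pos_simple[OF less.hyps t False]
        define \<delta> where "\<delta> = \<gamma> - \<tau>"
        have dp: "\<delta> \<in> Pos" "\<delta> \<in> I" using R I_diff[OF gI simple_pos[OF t(1)]] by (auto simp: \<delta>_def)
        have cfd: "cf \<delta> x = cf \<gamma> x - (if x = \<tau> then 1 else 0)" for x
          using less.hyps t by (simp add: \<delta>_def cf_simps)
        have hd: "ht \<delta> < ht \<gamma>" using less.hyps t by (simp add: \<delta>_def ht_diff cf_simps ht_simple)
        have IH: "cf \<delta> x \<le> 1" for x using less.IH dp hd by blast
        have "cf \<gamma> \<tau> \<le> 1"
        proof (rule ccontr)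
          assume "\<not> cf \<gamma> \<tau> \<le> 1"
          then have dt: "cf \<delta> \<tau> = 1" using cfd[of \<tau>] IH[of \<tau>] pos_cf_ge_2[OF less.hyps, of \<tau>] by auto
          define N where "N = \<gamma> \<bullet> \<gamma>"
          have Np: "0 < N" using pos_nonzero less.hyps by (simp add: N_def)
          \<comment> \<open>The neighbours of \<tau> in the support of \<delta>. All coefficients of
            \<delta> there, and at \<tau>, are 1, so \<open>\<delta> \<bullet> \<tau>\<close> is
            \<open>N\<close> minus \<open>card A\<close> halves of \<open>N\<close>. It equals minus
            one half of \<open>N\<close>, which forces exactly three neighbours.\<close>
          define A where "A = {x \<in> \<Delta>. 0 < cf \<delta> x \<and> x \<bullet> \<tau> < 0}"
          have nA: "\<tau> \<notin> A" using t R by (auto simp: A_def)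
          have fin: "finite A" using finite_simple by (simp add: A_def)
          have "\<delta> \<bullet> \<tau> = \<gamma> \<bullet> \<tau> - \<tau> \<bullet> \<tau>" by (simp add: \<delta>_def inner_diff_left)
          then have "\<delta> \<bullet> \<tau> = - N / 2" using R by (simp add: N_def)
          moreover have "\<delta> \<bullet> \<tau> = \<tau> \<bullet> \<tau> + (\<Sum>x\<in>\<Delta>-{\<tau>}. cf \<delta> x * (x \<bullet> \<tau>))"
            using inner_cf_remove[OF pos_span[OF dp(1)] t(1), of \<tau>] dt by simp
          moreover have "(\<Sum>x\<in>\<Delta>-{\<tau>}. cf \<delta> x * (x \<bullet> \<tau>)) = (\<Sum>x\<in>A. - N / 2)"
          proof (rule sum.mono_neutral_cong_right)
            show "finite (\<Delta> - {\<tau>})" using finite_simple by simp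
            show "A \<subseteq> \<Delta> - {\<tau>}" using nA by (auto simp: A_def)
            show "\<forall>x\<in>\<Delta> - {\<tau>} - A. cf \<delta> x * (x \<bullet> \<tau>) = 0"
            proof
              fix x assume "x \<in> \<Delta> - {\<tau>} - A"
              then show "cf \<delta> x * (x \<bullet> \<tau>) = 0"
                using simple_inner_nonpos[of x \<tau>] t(1) pos_cf_ge_0[OF dp(1), of x]
                by (auto simp: A_def)
            qed
            fix x assume x: "x \<in> A"
            then have "cf \<delta> x = 1" using IH[of x] pos_cf_ge_1[OF dp(1), of x] by (auto simp: A_def)
            then show "cf \<delta> x * (x \<bullet> \<tau>) = - N / 2"
              using adjacent_norm(2)[of x \<tau>] x t R by (auto simp: A_def N_def)
          qed
          ultimately have "- N / 2 = N - real (card A) * N / 2" using R by (simp add: N_def)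
          then have "(real (card A) - 3) * N = 0" by (simp add: algebra_simps)
          then have "card A = 3" using Np by simp
          then obtain p q r where pqr: "A = {p, q, r}" "p \<noteq> q" "p \<noteq> r" "q \<noteq> r"
            by (auto simp: card_3_iff)
          have D: "p \<in> \<Delta>" "q \<in> \<Delta>" "r \<in> \<Delta>" and n: "p \<bullet> \<tau> < 0" "q \<bullet> \<tau> < 0" "r \<bullet> \<tau> < 0"
            and c: "0 < cf \<delta> p" "0 < cf \<delta> q" "0 < cf \<delta> r"
            using pqr(1) by (auto simp: A_def set_eq_iff)
          have dt0: "0 < cf \<delta> \<tau>" using dt by simp
          have "distinct [p, \<tau>, q, r]" using pqr nA by auto
          then show False
            using no_star[OF D(1) t(1) D(2,3)] pqr(2-)
              path3_in_I[OF dp(2) D(1) t(1) D(2) pqr(2) n(1,2) c(1) dt0 c(2)]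
              path3_in_I[OF dp(2) D(1) t(1) D(3) pqr(3) n(1,3) c(1) dt0 c(3)]
              path3_in_I[OF dp(2) D(2) t(1) D(3) pqr(4) n(2,3) c(2) dt0 c(3)] by blast
        qed
        then show ?thesis using IH[of a] cfd[of a] by (auto split: if_splits)
      qed
    qed
  qed
  then show "\<gamma> \<in> I \<Longrightarrow> cf \<gamma> a \<le> 1" using I_pos[of \<gamma>] by simp
qed

lemma cf_eq_1: "\<gamma> \<in> I \<Longrightarrow> 0 < cf \<gamma> a \<Longrightarrow> cf \<gamma> a = 1"
  using cf_le_1[of \<gamma> a] pos_cf_ge_1[of \<gamma> a] I_pos[of \<gamma>] by simp

lemma cf_eq_0_or_1: "\<gamma> \<in> I \<Longrightarrow> cf \<gamma> a = 0 \<or> cf \<gamma> a = 1"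
  using cf_eq_1[of \<gamma> a] pos_cf_ge_0[of \<gamma> a] I_pos[of \<gamma>] by fastforce

text \<open>The descent must keep \<open>v\<close>. As \<open>v\<close> has coefficient 1, it
  contributes at most half of the norm of \<gamma>, so some other simple root contributes positively
  and can be subtracted.\<close>

lemma step_down:
  assumes "\<gamma> \<in> I" "v \<in> \<Delta>" "0 < cf \<gamma> v" "\<gamma> \<noteq> v"
  obtains \<tau> where "\<tau> \<in> \<Delta>" "\<tau> \<noteq> v" "0 < \<gamma> \<bullet> \<tau>" "cf \<gamma> \<tau> = 1" "\<gamma> - \<tau> \<in> I"
    "cf (\<gamma> - \<tau>) \<tau> = 0" "0 < cf (\<gamma> - \<tau>) v" "\<gamma> - \<tau> \<in> Pos" "(\<gamma> - \<tau>) \<bullet> \<tau> < 0"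
proof -
  have gp: "\<gamma> \<in> Pos" using I_pos assms by auto
  have N: "0 < \<gamma> \<bullet> \<gamma>" using pos_nonzero gp by auto
  have "\<exists>\<tau>\<in>\<Delta>. \<tau> \<noteq> v \<and> 0 < cf \<gamma> \<tau> * (\<gamma> \<bullet> \<tau>)"
  proof (rule ccontr)
    assume "\<not> ?thesis"
    then have "\<gamma> \<bullet> \<gamma> \<le> cf \<gamma> v * (\<gamma> \<bullet> v)" unfolding norm_eq_sum[OF pos_span[OF gp]]
      using assms finite_simple by (intro sum_le_one_term) (auto simp: not_less)
    moreover have "2 * (\<gamma> \<bullet> v) \<le> \<gamma> \<bullet> \<gamma>"
      using inner_pos_simple(2)[OF gp assms(2) _ assms(4)] N by (cases "0 < \<gamma> \<bullet> v") linarith+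
    ultimately show False using cf_eq_1[OF assms(1,3)] N by simp
  qed
  then obtain \<tau> where t: "\<tau> \<in> \<Delta>" "\<tau> \<noteq> v" "0 < cf \<gamma> \<tau> * (\<gamma> \<bullet> \<tau>)" by auto
  then have t0: "0 < \<gamma> \<bullet> \<tau>" "0 < cf \<gamma> \<tau>" using pos_cf_ge_0[OF gp, of \<tau>] by (auto simp: zero_less_mult_iff)
  have gt: "\<gamma> \<noteq> \<tau>" using assms t by (auto simp: cf_simple split: if_splits)
  note R = inner_pos_simple[OF gp t(1) t0(1) gt]
  have i: "\<gamma> - \<tau> \<in> I" using I_diff[OF assms(1) simple_pos[OF t(1)]] R by simp
  have "2 * ((\<gamma> - \<tau>) \<bullet> \<tau>) = - (\<gamma> \<bullet> \<gamma>)" using R by (simp add: inner_diff_left)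
  then have n: "(\<gamma> - \<tau>) \<bullet> \<tau> < 0" using N by linarith
  have c1: "cf \<gamma> \<tau> = 1" using cf_eq_1 assms t0 by auto
  have cfs: "cf (\<gamma> - \<tau>) \<tau> = 0" "0 < cf (\<gamma> - \<tau>) v" using c1 gp t assms by (auto simp: cf_simps)
  show ?thesis by (rule that[OF t(1,2) t0(1) c1 i cfs R(3) n])
qed

text \<open>Roots of such a chain meet at 60 degrees. The larger root is lowered towards the smaller
  one; all simple roots removed on the way, except the last, are orthogonal to the smaller
  root.\<close>

lemma inner_chain_above:
  assumes ch: "Complete_Partial_Order.chain le (above v)" and v: "v \<in> \<Delta>"
    and "\<gamma> \<in> above v" "\<gamma>' \<in> above v" "le \<gamma> \<gamma>'" "\<gamma> \<noteq> \<gamma>'"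
  shows "2 * (\<gamma>' \<bullet> \<gamma>) = \<gamma> \<bullet> \<gamma>"
proof -
  have g: "\<gamma> \<in> I" "\<gamma> \<in> Pos" "0 < cf \<gamma> v" using assms I_pos by (auto simp: above_def)
  have N: "0 < \<gamma> \<bullet> \<gamma>" using pos_nonzero g by auto
  have "\<gamma>' \<in> Pos" using assms I_pos by (auto simp: above_def)
  then have "\<gamma>' \<in> above v \<longrightarrow> le \<gamma> \<gamma>' \<longrightarrow> \<gamma> \<noteq> \<gamma>' \<longrightarrow> 2 * (\<gamma>' \<bullet> \<gamma>) = \<gamma> \<bullet> \<gamma>"
  proof (induction \<gamma>' rule: pos_induct)
    case (less y)
    show ?case
    proof (intro impI)
      assume y: "y \<in> above v" and yle: "le \<gamma> y" and yne: "\<gamma> \<noteq> y"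
      have yI: "y \<in> I" "0 < cf y v" using y by (auto simp: above_def)
      have yv: "y \<noteq> v"
      proof
        assume "y = v"
        then have "le y \<gamma>" using simple_le_iff v g by auto
        then show False using le_antisym yle yne g less.hyps by blast
      qed
      obtain \<tau> where t: "\<tau> \<in> \<Delta>" "\<tau> \<noteq> v" "0 < y \<bullet> \<tau>" "cf y \<tau> = 1" "y - \<tau> \<in> I"
        "cf (y - \<tau>) \<tau> = 0" "0 < cf (y - \<tau>) v" "y - \<tau> \<in> Pos" "(y - \<tau>) \<bullet> \<tau> < 0"
        using step_down[OF yI(1) v yI(2) yv] .
      define z where "z = y - \<tau>"
      have z: "z \<in> above v" "z \<in> Pos" "cf z \<tau> = 0" "z \<bullet> \<tau> < 0" using t by (auto simp: z_def above_def)
      have hz: "ht y = ht z + 1" using less.hyps t by (simp add: z_def ht_diff cf_simps ht_simple)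
      have cfz: "cf y x = cf z x + (if x = \<tau> then 1 else 0)" for x
        using less.hyps t by (simp add: z_def cf_simps)
      have gz: "le \<gamma> z"
      proof (rule ccontr)
        assume "\<not> le \<gamma> z"
        then have zl: "le z \<gamma>" using ch z(1) assms(3) unfolding Complete_Partial_Order.chain_def by blast
        \<comment> \<open>Now \<gamma> would lie strictly between \<open>z\<close> and
          \<open>y\<close>, whose heights differ by 1.\<close>
        have "ht z < ht \<gamma>" "ht \<gamma> < ht y"
          using le_ht_eq[OF z(2) g(2) zl] \<open>\<not> le \<gamma> z\<close> zl le_ht_eq[OF g(2) less.hyps yle] yne by force+
        then show False using hz ht_Nats[OF z(2)] ht_Nats[OF g(2)] by (auto elim!: Nats_cases)
      qed
      have gt: "cf \<gamma> \<tau> = 0" using gz z(3) pos_cf_ge_0[OF g(2), of \<tau>] t(1) by (force simp: root_le_def)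
      show "2 * (y \<bullet> \<gamma>) = \<gamma> \<bullet> \<gamma>"
      proof (cases "\<gamma> = z")
        case True
        have *: "2 * (z \<bullet> \<tau>) = - (z \<bullet> z)" using inner_neg_simple(2)[OF z(2) t(1) z(4)] .
        have "y = z + \<tau>" by (simp add: z_def)
        then have "2 * (y \<bullet> z) = 2 * (z \<bullet> z) + 2 * (z \<bullet> \<tau>)"
          by (simp add: inner_add_left inner_commute[of \<tau>])
        with * show ?thesis by (simp add: True)
      next
        case False
        then have IH: "2 * (z \<bullet> \<gamma>) = \<gamma> \<bullet> \<gamma>" using less.IH[OF z(2)] hz z gz by auto
        \<comment> \<open>Otherwise \<open>\<gamma> + \<tau>\<close> would belong to the chain but
          be incomparable to \<open>z\<close>: it contains \<tau>, which \<open>z\<close> lacks,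
          while \<open>z\<close> exceeds \<gamma> at some other node.\<close>
        have "\<gamma> \<bullet> \<tau> = 0"
        proof (rule ccontr)
          assume "\<gamma> \<bullet> \<tau> \<noteq> 0"
          then have "\<gamma> \<bullet> \<tau> < 0" using off_support_inner_nonpos[OF g(2) t(1) gt] by simp
          then have w: "\<gamma> + \<tau> \<in> Pos" using inner_neg_simple g t by auto
          have wy: "le (\<gamma> + \<tau>) y" using gz cfz g t by (auto simp: root_le_def cf_simps)
          have wa: "\<gamma> + \<tau> \<in> above v" using I_down[OF yI(1) w wy] g t by (auto simp: above_def cf_simps)
          have "le z (\<gamma> + \<tau>)"
          proof (rule ccontr)
            assume "\<not> ?thesis"
            then have "le (\<gamma> + \<tau>) z" using ch wa z(1) unfolding Complete_Partial_Order.chain_def by blast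
            then show False using z(3) gt g t by (auto simp: root_le_def cf_simps)
          qed
          then have "cf z x \<le> cf \<gamma> x" if "x \<in> \<Delta>" for x
            using that z(3) gt g t by (cases "x = \<tau>") (auto simp: root_le_def cf_simps)
          then show False using le_antisym[OF g(2) z(2) gz] False by (auto simp: root_le_def)
        qed
        then show ?thesis using IH by (simp add: z_def inner_diff_left inner_commute[of \<tau>])
      qed
    qed
  qed
  then show ?thesis using assms by blast
qed

text \<open>The angle of 60 degrees makes the difference a root, and both coefficients at
  \<open>v\<close> are 1, so \<open>v\<close> cancels. Thus the plane of two elements of the block
  meets the remaining ideal, as condition (2) of supersolvability demands.\<close>

lemma diff_chain_above:
  assumes ch: "Complete_Partial_Order.chain le (above v)" and v: "v \<in> \<Delta>"
    and g: "\<gamma> \<in> above v" and g': "\<gamma>' \<in> above v" and "le \<gamma> \<gamma>'" "\<gamma> \<noteq> \<gamma>'"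
  shows "\<gamma>' - \<gamma> \<in> I - above v"
proof -
  have p: "\<gamma> \<in> Pos" "\<gamma>' \<in> Pos" "\<gamma> \<in> I" "\<gamma>' \<in> I" "0 < cf \<gamma> v" "0 < cf \<gamma>' v"
    using g g' I_pos by (auto simp: above_def)
  have n: "\<gamma>' \<bullet> \<gamma>' = \<gamma> \<bullet> \<gamma>" using norm_support[OF p(1) v p(5)] norm_support[OF p(2) v p(6)] by simp
  have "0 < \<gamma>' \<bullet> \<gamma>" using inner_chain_above[OF assms] pos_nonzero[OF p(1)] by linarith
  moreover have "\<gamma>' \<noteq> - \<gamma>" using p pos_minus by auto
  ultimately have "\<gamma>' - \<gamma> \<in> \<Phi>" using same_norm_inner(2)[OF pos_root[OF p(2)] pos_root[OF p(1)] n] assms(6) by simp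
  then have "\<gamma>' - \<gamma> \<in> Pos" using assms p by (intro posI_nonneg) (auto simp: root_le_def cf_simps)
  then show ?thesis using I_diff[OF p(4,1)] cf_eq_1[OF p(3,5)] cf_eq_1[OF p(4,6)] p
    by (auto simp: above_def cf_simps)
qed

text \<open>The support of \<open>x\<close> contains an edge leaving the support of
  \<open>z\<close>, and \<open>b\<close> is its outer end. Coefficients are 0 or 1, so adding
  \<open>b\<close> stays below \<open>x\<close>.\<close>

lemma step_up:
  assumes z: "z \<in> I" and x: "x \<in> I" and zx: "le z x" "\<not> le x z"
  obtains b where "b \<in> \<Delta>" "z + b \<in> I" "le (z + b) x"
proof -
  have zp: "z \<in> Pos" "x \<in> Pos" using z x I_pos by auto
  obtain t where t: "t \<in> \<Delta>" "cf z t < cf x t" using zx by (force simp: root_le_def)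
  then have t': "cf z t = 0" "0 < cf x t" using cf_eq_0_or_1[OF z, of t] cf_eq_0_or_1[OF x, of t] by auto
  obtain s where s: "s \<in> \<Delta>" "0 < cf z s" using pos_obtain_cf zp by blast
  then have s': "0 < cf x s" using zx by (force simp: root_le_def)
  obtain a b where ab: "a \<in> \<Delta>" "b \<in> \<Delta>" "0 < cf z a" "\<not> 0 < cf z b" "0 < cf x b" "a \<bullet> b < 0"
    using support_connected[OF zp(2) s(1) _ s' t(1) _ t'(2), of "{a. 0 < cf z a}"] s t' by auto
  then have b0: "cf z b = 0" using pos_cf_ge_0[OF zp(1), of b] by simp
  have zb: "z + b \<in> Pos" using add_adjacent_simple(2)[OF zp(1) ab(2) b0 ab(1,3,6)] .
  have le: "le (z + b) x" unfolding root_le_def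
  proof
    fix c assume "c \<in> \<Delta>"
    then show "cf (z + b) c \<le> cf x c"
      using zx ab b0 zp cf_eq_1[OF x ab(5)] by (simp add: cf_add pos_span simple_span cf_simple root_le_def)
  qed
  show ?thesis by (rule that[OF ab(2) I_down[OF x zb le] le])
qed

text \<open>In the conclusion \<tau> is a branch node, \<open>p\<close> is its neighbour on the side
  of \<open>v\<close>, and \<delta> witnesses that \<open>v\<close> and \<open>p\<close> are
  connected without passing through \<tau>.\<close>

lemma not_chain_obtains_branch:
  assumes v: "v \<in> \<Delta>" "v \<in> I"
    and leaf: "\<not> (\<exists>w\<in>\<Delta>. \<exists>w'\<in>\<Delta>. w \<noteq> w' \<and> v + w \<in> I \<and> v + w' \<in> I)"
    and nch: "\<not> Complete_Partial_Order.chain le (above v)"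
  obtains \<delta> \<tau> p b b' where "\<delta> \<in> Pos" "0 < cf \<delta> v" "0 < cf \<delta> p" "cf \<delta> \<tau> = 0"
    "\<tau> \<in> \<Delta>" "p \<in> \<Delta>" "b \<in> \<Delta>" "b' \<in> \<Delta>" "distinct [p, b, b']"
    "p \<bullet> \<tau> < 0" "b \<bullet> \<tau> < 0" "b' \<bullet> \<tau> < 0" "p + \<tau> + b \<in> I" "p + \<tau> + b' \<in> I"
proof -
  \<comment> \<open>The lowest root above \<open>v\<close> with two extensions in \<open>I\<close> is the path from \<open>v\<close> to a branch node.\<close>
  define S where "S = {\<gamma> \<in> above v. \<exists>b b'. b \<in> \<Delta> \<and> b' \<in> \<Delta> \<and> b \<noteq> b' \<and> \<gamma> + b \<in> I \<and> \<gamma> + b' \<in> I}"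
  have finab: "finite (above v)" using finite_I by (simp add: above_def)
  obtain x y where xy: "x \<in> above v" "y \<in> above v" "\<not> le x y" "\<not> le y x"
    using nch unfolding Complete_Partial_Order.chain_def by blast
  then have xI: "x \<in> I" "0 < cf x v" "y \<in> I" "0 < cf y v" by (auto simp: above_def)
  \<comment> \<open>For a common lower bound of maximal height, the steps towards \<open>x\<close>
    and towards \<open>y\<close> must differ. This makes \<open>S\<close> nonempty.\<close>
  define Z where "Z = {z \<in> above v. le z x \<and> le z y}"
  have "v \<in> Z" using v xI I_pos by (simp add: Z_def above_def simple_le_iff cf_simple)
  moreover have "finite Z" using finab by (simp add: Z_def)
  ultimately obtain z where z: "z \<in> Z" and zmax: "\<And>u. u \<in> Z \<Longrightarrow> ht u \<le> ht z"
    using finite_obtains_max[of Z ht] by (metis empty_iff)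
  have zI: "z \<in> I" "0 < cf z v" "le z x" "le z y" using z by (auto simp: Z_def above_def)
  have zn: "\<not> le x z" "\<not> le y z" using xy zI unfolding root_le_def by force+
  obtain b where b: "b \<in> \<Delta>" "z + b \<in> I" "le (z + b) x" using step_up[OF zI(1) xI(1) zI(3) zn(1)] .
  obtain b' where b': "b' \<in> \<Delta>" "z + b' \<in> I" "le (z + b') y" using step_up[OF zI(1) xI(3) zI(4) zn(2)] .
  have "b \<noteq> b'"
  proof
    assume "b = b'"
    then have "z + b \<in> Z" using b b' zI v I_pos pos_cf_ge_0[OF simple_pos[OF b(1)], of v]
      by (auto simp: Z_def above_def cf_add pos_span simple_span)
    from zmax[OF this] show False using I_pos zI b by (simp add: ht_add pos_span simple_span ht_simple)
  qed
  then have "z \<in> S" using z b b' by (auto simp: S_def Z_def)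
  moreover have "finite S" using finab by (simp add: S_def)
  ultimately obtain \<gamma> where g: "\<gamma> \<in> S" and gmin: "\<And>u. u \<in> S \<Longrightarrow> ht \<gamma> \<le> ht u"
    using finite_obtains_min[of S ht] by (metis empty_iff)
  then obtain b b' where b: "b \<in> \<Delta>" "b' \<in> \<Delta>" "b \<noteq> b'" "\<gamma> + b \<in> I" "\<gamma> + b' \<in> I"
    by (auto simp: S_def)
  have gI: "\<gamma> \<in> I" "0 < cf \<gamma> v" using g by (auto simp: S_def above_def)
  have gp: "\<gamma> \<in> Pos" using gI I_pos by auto
  have gv: "\<gamma> \<noteq> v" using leaf b by auto
  obtain \<tau> where t: "\<tau> \<in> \<Delta>" "\<tau> \<noteq> v" "0 < \<gamma> \<bullet> \<tau>" "cf \<gamma> \<tau> = 1" "\<gamma> - \<tau> \<in> I"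
    "cf (\<gamma> - \<tau>) \<tau> = 0" "0 < cf (\<gamma> - \<tau>) v" "\<gamma> - \<tau> \<in> Pos" "(\<gamma> - \<tau>) \<bullet> \<tau> < 0"
    using step_down[OF gI(1) v(1) gI(2) gv] .
  \<comment> \<open>An extension of \<gamma> not joined to \<tau> would already be available at
    \<open>\<gamma> - \<tau>\<close>, next to the extension by \<tau> itself, contrary to the
    minimality of \<gamma>.\<close>
  have off: "cf \<gamma> a = 0" "a \<bullet> \<tau> < 0" if a: "a \<in> \<Delta>" "\<gamma> + a \<in> I" for a
  proof -
    have "cf (\<gamma> + a) a \<le> 1" using cf_le_1 a by auto
    then show c0: "cf \<gamma> a = 0" using cf_eq_0_or_1[OF gI(1), of a] gp a
      by (auto simp: cf_add pos_span simple_span cf_simple)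
    then have at: "a \<noteq> \<tau>" using t by auto
    show "a \<bullet> \<tau> < 0"
    proof (rule ccontr)
      assume "\<not> a \<bullet> \<tau> < 0"
      then have "a \<bullet> \<tau> = 0" using simple_inner_nonpos[OF a(1) t(1) at] by simp
      then have "(\<gamma> - \<tau>) \<bullet> a < 0" using add_simple_inner[OF gp a(1) I_pos[OF a(2)]]
        by (simp add: inner_diff_left inner_commute[of \<tau>])
      then have w: "\<gamma> - \<tau> + a \<in> Pos" using inner_neg_simple(3)[OF t(8) a(1)] by simp
      have "le (\<gamma> - \<tau> + a) (\<gamma> + a)" unfolding root_le_def
        using gp t(1,8) a(1) by (simp add: cf_add cf_diff pos_span simple_span cf_simple)
      then have "\<gamma> - \<tau> + a \<in> I" using I_down[OF a(2) w] by simp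
      moreover have "\<gamma> - \<tau> + \<tau> \<in> I" using gI by simp
      ultimately have "\<gamma> - \<tau> \<in> S" using t a at unfolding S_def above_def by blast
      from gmin[OF this] show False using gp t(1) by (simp add: ht_diff pos_span simple_span ht_simple)
    qed
  qed
  obtain p where p: "p \<in> \<Delta>" "0 < cf (\<gamma> - \<tau>) p" "p \<bullet> \<tau> < 0"
    using inner_neg_obtains_adjacent[OF t(8,1,9)] .
  have pt: "p \<noteq> \<tau>" using adjacent_ne p by auto
  have gpp: "0 < cf \<gamma> p" using p gp t pt by (simp add: cf_diff pos_span simple_span cf_simple)
  have in_I: "p + \<tau> + a \<in> I" if a: "a \<in> \<Delta>" "\<gamma> + a \<in> I" for a
  proof (rule path3_in_I[OF a(2) p(1) t(1) a(1) _ p(3) off(2)[OF a]])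
    show "p \<noteq> a" using off(1)[OF a] gpp by auto
    show "0 < cf (\<gamma> + a) p" "0 < cf (\<gamma> + a) \<tau>" "0 < cf (\<gamma> + a) a"
      using gpp t(4) gp a off(1)[OF a]
      by (simp_all add: cf_add pos_span simple_span cf_simple)
  qed
  have d: "distinct [p, b, b']" using b off(1)[OF b(1,4)] off(1)[OF b(2,5)] gpp by auto
  show ?thesis
    by (rule that[OF t(8,7) p(2) t(6,1) p(1) b(1,2) d p(3) off(2)[OF b(1,4)] off(2)[OF b(2,5)]
          in_I[OF b(1,4)] in_I[OF b(2,5)]])
qed

end

section \<open>Nodes of small degree in the Dynkin diagram\<close>

context simply_laced_root_system
begin

text \<open>In the sum, \<open>v\<close> itself contributes \<open>v \<bullet> v\<close>, each
  neighbour removes half of it, and nothing else is positive.\<close>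

lemma sum_inner_simple:
  assumes "X \<subseteq> \<Delta>" "v \<in> X" "w \<in> X" "w \<bullet> v < 0"
  shows "2 * (\<Sum>X \<bullet> v) \<le> v \<bullet> v"
    and "w' \<in> X \<Longrightarrow> w' \<noteq> w \<Longrightarrow> w' \<bullet> v < 0 \<Longrightarrow> \<Sum>X \<bullet> v \<le> 0"
proof -
  have fin: "finite X" using assms finite_simple finite_subset by auto
  have ne: "w \<noteq> v" using adjacent_ne assms by auto
  have s: "\<Sum>X \<bullet> v = v \<bullet> v + (\<Sum>x\<in>X-{v}. x \<bullet> v)"
    using fin assms sum.remove[of X v "\<lambda>x. x \<bullet> v"] by (simp add: inner_sum_left)
  have nonpos: "x \<bullet> v \<le> 0" if "x \<in> X - {v}" for x using simple_inner_nonpos that assms by blast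
  have n: "2 * (u \<bullet> v) = - (v \<bullet> v)" if "u \<in> X" "u \<bullet> v < 0" for u
    using adjacent_norm(2) that assms by blast
  have "(\<Sum>x\<in>X-{v}. x \<bullet> v) \<le> w \<bullet> v"
    using fin assms ne nonpos by (intro sum_le_one_term) auto
  then show "2 * (\<Sum>X \<bullet> v) \<le> v \<bullet> v" using s n[of w] assms by linarith
  assume w': "w' \<in> X" "w' \<noteq> w" "w' \<bullet> v < 0"
  then have "w' \<noteq> v" using adjacent_ne assms by auto
  then have "(\<Sum>x\<in>X-{v}. x \<bullet> v) \<le> w \<bullet> v + w' \<bullet> v"
    using fin assms ne w' nonpos by (intro sum_le_two_terms) auto
  then show "\<Sum>X \<bullet> v \<le> 0" using s n[of w] n[of w'] assms w' by linarith
qed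

lemma cf_Sum: "X \<subseteq> \<Delta> \<Longrightarrow> cf (\<Sum>X) a = (if a \<in> X then 1 else 0)"
proof -
  assume X: "X \<subseteq> \<Delta>"
  then have fin: "finite X" using finite_simple finite_subset by auto
  have "cf (\<Sum>X) a = (\<Sum>x\<in>X. cf x a)"
    using indep X simple_span by (subst representation_sum) auto
  also have "\<dots> = (\<Sum>x\<in>X. if x = a then 1 else 0)" using X by (intro sum.cong) (auto simp: cf_simple)
  finally show ?thesis using fin by simp
qed

lemma Sum_span: "X \<subseteq> \<Delta> \<Longrightarrow> \<Sum>X \<in> span \<Delta>"
  by (rule span_sum) (use simple_span in auto)

text \<open>The sum of \<open>X\<close> would have norm at most 0 although \<open>X\<close> is
  independent. This is the source of the first leaf in \<open>exists_chain_above\<close>.\<close>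

lemma all_degrees_ge_2_impossible:
  assumes "X \<subseteq> \<Delta>" "X \<noteq> {}"
    and "\<And>v. v \<in> X \<Longrightarrow> \<exists>w\<in>X. \<exists>w'\<in>X. w \<noteq> w' \<and> w \<bullet> v < 0 \<and> w' \<bullet> v < 0"
  shows False
proof -
  have "\<Sum>X \<bullet> v \<le> 0" if "v \<in> X" for v using assms(3)[OF that] sum_inner_simple(2)[OF assms(1) that] by blast
  then have "\<Sum>X \<bullet> \<Sum>X \<le> 0" using inner_sum_right[of "\<Sum>X" "\<lambda>x. x" X] by (simp add: sum_nonpos)
  then have "\<Sum>X = 0" by (metis inner_gt_zero_iff not_le)
  then have "cf (\<Sum>X) a = 0" for a by (simp add: cf_zero)
  then show False using assms(2) cf_Sum[OF assms(1)] by (metis ex_in_conv zero_neq_one)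
qed

text \<open>
  Under these hypotheses \<open>2 \<Sum>X + 2 c + p + r\<close> would be isotropic.
\<close>

lemma branch_has_leaf:
  assumes X: "X \<subseteq> \<Delta>" "q \<in> X" and c: "c \<in> \<Delta>" "p \<in> \<Delta>" "r \<in> \<Delta>" "p \<noteq> r" "c \<notin> X" "p \<notin> X" "r \<notin> X"
    and adj: "q \<bullet> c < 0" "p \<bullet> c < 0" "r \<bullet> c < 0"
    and deg: "\<And>v. v \<in> X \<Longrightarrow> v \<noteq> q \<Longrightarrow> \<exists>w\<in>X. \<exists>w'\<in>X. w \<noteq> w' \<and> w \<bullet> v < 0 \<and> w' \<bullet> v < 0"
    and degq: "\<exists>w\<in>X. w \<bullet> q < 0"
  shows False
proof -
  define x where "x = \<Sum>X"
  have fin: "finite X" using X finite_simple finite_subset by auto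
  have qD: "q \<in> \<Delta>" using X by auto
  have nX: "x \<bullet> u \<le> 0" if "u \<in> \<Delta>" "u \<notin> X" for u
    unfolding x_def inner_sum_left
    by (intro sum_nonpos simple_inner_nonpos) (use that X in auto)
  have "x \<bullet> v \<le> 0" if "v \<in> X" "v \<noteq> q" for v
    unfolding x_def using deg[OF that] sum_inner_simple(2)[OF X(1) that(1)] by blast
  \<comment> \<open>Only \<open>q\<close> can contribute positively to the norm of \<open>x\<close>,
    since every other node of \<open>X\<close> has two neighbours in \<open>X\<close>.\<close>
  then have "x \<bullet> x \<le> x \<bullet> q"
    by (subst (2) x_def) (use fin X in \<open>auto simp: inner_sum_right intro: sum_le_one_term\<close>)
  moreover have "2 * (x \<bullet> q) \<le> q \<bullet> q"
    unfolding x_def using degq sum_inner_simple(1)[OF X] by blast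
  ultimately have xx: "2 * (x \<bullet> x) \<le> q \<bullet> q" by linarith
  have "x \<bullet> c \<le> q \<bullet> c"
    unfolding x_def inner_sum_left
    by (intro sum_le_one_term simple_inner_nonpos) (use fin X c in auto)
  moreover note adjacent_norm[OF qD c(1) adj(1)] adjacent_norm[OF c(2,1) adj(2)] adjacent_norm[OF c(3,1) adj(3)]
    nX[OF c(2,6)] nX[OF c(3,7)] simple_inner_nonpos[OF c(2,3,4)] xx
  moreover define y where "y = 2 *\<^sub>R x + 2 *\<^sub>R c + p + r"
  have "y \<bullet> y = 4 * (x \<bullet> x) + 4 * (c \<bullet> c) + p \<bullet> p + r \<bullet> r + 8 * (x \<bullet> c) + 4 * (p \<bullet> c) + 4 * (r \<bullet> c)
     + 4 * (x \<bullet> p) + 4 * (x \<bullet> r) + 2 * (p \<bullet> r)"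
    by (simp add: y_def inner_add_left inner_add_right inner_commute)
  ultimately have "y \<bullet> y \<le> 0" by linarith
  then have "y = 0" by (metis inner_gt_zero_iff not_le)
  then have "cf y q = 0" by (simp add: cf_zero)
  moreover have "cf y q \<ge> 2"
    using X c by (auto simp: y_def x_def cf_add cf_scale cf_Sum Sum_span simple_span span_add span_scale cf_simple)
  ultimately show False by simp
qed

end

section \<open>A simple root with a chain above it\<close>

context nonstar_ideal
begin

lemma add_simple_in_I:
  assumes "v \<in> \<Delta>" "w \<in> \<Delta>" "v + w \<in> I"
  shows "w \<bullet> v < 0" "w \<in> I" "w \<noteq> v"
proof -
  have p: "v + w \<in> Pos" using I_pos assms by auto
  show "w \<bullet> v < 0" using add_simple_inner[OF simple_pos[OF assms(1)] assms(2) p] by (simp add: inner_commute)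
  then show "w \<noteq> v" using adjacent_ne assms by auto
  show "w \<in> I" using I_simple[OF assms(3,2)] assms
    by (simp add: cf_add simple_span cf_simple)
qed

text \<open>By contradiction. Call simple roots linked if their sum is in \<open>I\<close>. A leaf
  for this relation leads to a branch node \<open>c\<close>; a leaf in another arm leads to
  \<open>c\<close> again from that side, and the roots of height 3 found at \<open>c\<close>
  complete a star.\<close>

lemma exists_chain_above:
  assumes "I \<noteq> {}"
  obtains v where "v \<in> \<Delta>" "v \<in> I" "Complete_Partial_Order.chain le (above v)"
proof -
  note goal = that
  show ?thesis
  proof (rule ccontr)
    assume "\<not> thesis"
    then have nch: "\<not> Complete_Partial_Order.chain le (above v)" if "v \<in> \<Delta>" "v \<in> I" for v
      using that goal[of v] by blast
    define V where "V = \<Delta> \<inter> I"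
    obtain x where x: "x \<in> I" using assms by auto
    then obtain a where "a \<in> \<Delta>" "0 < cf x a" using I_pos pos_obtain_cf by blast
    then have "a \<in> V" using I_simple x by (auto simp: V_def)
    then have "\<exists>v\<in>V. \<not> (\<exists>w\<in>\<Delta>. \<exists>w'\<in>\<Delta>. w \<noteq> w' \<and> v + w \<in> I \<and> v + w' \<in> I)"
      using all_degrees_ge_2_impossible[of V] add_simple_in_I unfolding V_def
      by (metis Int_iff Int_lower1 empty_iff)
    then obtain v0 where v0: "v0 \<in> \<Delta>" "v0 \<in> I"
      "\<not> (\<exists>w\<in>\<Delta>. \<exists>w'\<in>\<Delta>. w \<noteq> w' \<and> v0 + w \<in> I \<and> v0 + w' \<in> I)" by (auto simp: V_def)
    obtain c p q r where c: "c \<in> \<Delta>" "p \<in> \<Delta>" "q \<in> \<Delta>" "r \<in> \<Delta>" and d: "distinct [p, q, r]"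
      and adj: "p \<bullet> c < 0" "q \<bullet> c < 0" "r \<bullet> c < 0" and I2: "p + c + q \<in> I" "p + c + r \<in> I"
      by (rule not_chain_obtains_branch[OF v0 nch[OF v0(1,2)]]) (rule that; assumption)
    have ne: "p \<noteq> c" "q \<noteq> c" "r \<noteq> c" using adjacent_ne c adj by auto
    have nI: "q + c + r \<notin> I" using no_star[OF c(2,1,3,4)] d ne I2 by auto
    have qI: "q \<in> I" using I_simple[OF I2(1) c(3)] c d ne by (simp add: cf_simps)
    \<comment> \<open>The support of \<theta> is the arm of \<open>q\<close>: its component after
      deleting \<open>c\<close>. Since there are no cycles, \<open>q\<close> is the only neighbour
      of \<open>c\<close> in it.\<close>
    obtain \<theta> where th: "saturated_off {c} \<theta>" "0 < cf \<theta> q"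
      using saturated_off_exists[OF c(3), of "{c}"] ne by blast
    have thp: "\<theta> \<in> Pos" "cf \<theta> c = 0" using th by (auto simp: saturated_off_def)
    have only_q: "u = q" if "u \<in> \<Delta>" "0 < cf \<theta> u" "u \<bullet> c < 0" for u
      using no_two_attachments[OF thp(1) c(1) thp(2) that c(3) th(2) adj(2)] .
    \<comment> \<open>The support of \<Theta> is the whole component of \<open>c\<close>, inside
      which \<open>branch_node_unique\<close> applies.\<close>
    obtain \<Theta> where Th: "saturated_off {} \<Theta>" "0 < cf \<Theta> c"
      using saturated_off_exists[OF c(1), of "{}"] by blast
    have Thp: "\<Theta> \<in> Pos" using Th by (auto simp: saturated_off_def)
    have comp: "0 < cf \<Theta> t" if "\<gamma> \<in> Pos" "s \<in> \<Delta>" "0 < cf \<gamma> s" "0 < cf \<Theta> s" "t \<in> \<Delta>" "0 < cf \<gamma> t" for \<gamma> s t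
      using saturated_off_support[OF Th(1) that(1) _ that(2-)] by blast
    have cq: "c + q \<in> Pos" using path3_pos(1)[OF c(3,1,2)] d adj by auto
    have Thq: "0 < cf \<Theta> q" using comp[OF cq c(1) _ Th(2) c(3)] c ne by (simp add: cf_simps)
    \<comment> \<open>The nodes of the arm that lie in \<open>I\<close>. As \<open>nb\<close> and
      \<open>nbc\<close> show, the only link that can leave \<open>X\<close> is the one from
      \<open>q\<close> to \<open>c\<close>.\<close>
    define X where "X = {u \<in> \<Delta>. 0 < cf \<theta> u \<and> u \<in> I}"
    have qX: "q \<in> X" using qI c th by (simp add: X_def)
    have nb: "w \<in> X" if v: "v \<in> X" and w: "w \<in> \<Delta>" "v + w \<in> I" "w \<noteq> c" for v w
    proof -
      have vD: "v \<in> \<Delta>" "0 < cf \<theta> v" "v \<in> I" "v \<noteq> c" using v thp by (auto simp: X_def)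
      have "0 < cf \<theta> w"
        by (rule saturated_off_support[OF th(1) I_pos[OF w(2)] _ vD(1) _ vD(2) w(1)])
          (use vD w c in \<open>auto simp: cf_add simple_span cf_simple\<close>)
      then show ?thesis using add_simple_in_I[OF vD(1) w(1,2)] w by (simp add: X_def)
    qed
    have nbc: "v = q" if "v \<in> X" "v + c \<in> I" for v
      using that only_q[of v] add_simple_in_I(1)[of v c] c by (auto simp: X_def inner_commute)
    \<comment> \<open>Without a leaf, every node of \<open>X\<close> other than \<open>q\<close>
      would have two neighbours in \<open>X\<close>, and \<open>q\<close> at least one, because only
      one of its two links can go to \<open>c\<close>. This is what \<open>branch_has_leaf\<close>
      excludes.\<close>
    have "\<exists>v\<in>X. \<not> (\<exists>w\<in>\<Delta>. \<exists>w'\<in>\<Delta>. w \<noteq> w' \<and> v + w \<in> I \<and> v + w' \<in> I)"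
    proof (rule ccontr)
      assume n: "\<not> ?thesis"
      show False
      proof (rule branch_has_leaf[of X q c p r])
        show "X \<subseteq> \<Delta>" by (auto simp: X_def)
        show "q \<in> X" by (fact qX)
        show "p \<noteq> r" using d by simp
        show "c \<notin> X" "p \<notin> X" "r \<notin> X" using thp only_q[of p] only_q[of r] adj d by (auto simp: X_def)
        show "\<exists>w\<in>X. \<exists>w'\<in>X. w \<noteq> w' \<and> w \<bullet> v < 0 \<and> w' \<bullet> v < 0" if v: "v \<in> X" "v \<noteq> q" for v
        proof -
          obtain w w' where w: "w \<in> \<Delta>" "w' \<in> \<Delta>" "w \<noteq> w'" "v + w \<in> I" "v + w' \<in> I" using n v by blast
          moreover have "w \<noteq> c" "w' \<noteq> c" using nbc v w by auto
          ultimately show ?thesis using nb[OF v(1)] add_simple_in_I(1)[of v] v by (metis (no_types, lifting) X_def mem_Collect_eq)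
        qed
        obtain w w' where w: "w \<in> \<Delta>" "w' \<in> \<Delta>" "w \<noteq> w'" "q + w \<in> I" "q + w' \<in> I" using n qX by blast
        then show "\<exists>w\<in>X. w \<bullet> q < 0" using nb[OF qX] add_simple_in_I(1)[OF c(3)] by metis
      qed (use c adj in auto)
    qed
    then obtain v where v: "v \<in> X" "\<not> (\<exists>w\<in>\<Delta>. \<exists>w'\<in>\<Delta>. w \<noteq> w' \<and> v + w \<in> I \<and> v + w' \<in> I)" by blast
    then have vD: "v \<in> \<Delta>" "v \<in> I" "0 < cf \<theta> v" by (auto simp: X_def)
    obtain \<delta> \<tau> p' b b' where del: "\<delta> \<in> Pos" "0 < cf \<delta> v" "0 < cf \<delta> p'" "cf \<delta> \<tau> = 0"
      and D: "\<tau> \<in> \<Delta>" "p' \<in> \<Delta>" "b \<in> \<Delta>" "b' \<in> \<Delta>" and d': "distinct [p', b, b']"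
      and adj': "p' \<bullet> \<tau> < 0" "b \<bullet> \<tau> < 0" "b' \<bullet> \<tau> < 0" and I3: "p' + \<tau> + b \<in> I" "p' + \<tau> + b' \<in> I"
      by (rule not_chain_obtains_branch[OF vD(1,2) v(2) nch[OF vD(1,2)]]) (rule that; assumption)
    have Thv: "0 < cf \<Theta> v" using comp[OF thp(1) c(3) th(2) Thq vD(1,3)] .
    have "0 < cf \<Theta> p'" using comp[OF del(1) vD(1) del(2) Thv D(2) del(3)] .
    moreover have "p' \<noteq> \<tau>" using adjacent_ne D adj' by auto
    moreover have "\<tau> + p' \<in> Pos" using path3_pos(1)[OF D(2,1,3)] d' adj' by auto
    ultimately have "0 < cf \<Theta> \<tau>" using comp[of "\<tau> + p'" p' \<tau>] D by (simp add: cf_simps)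
    then have tc: "\<tau> = c"
      using branch_node_unique[OF Thp D(1) _ c(1) Th(2) D(2-4) d' adj' c(2-4) d adj] by simp
    have "c \<bullet> p < 0" "c \<bullet> q < 0" "c \<bullet> r < 0" "c \<bullet> p' < 0" "c \<bullet> b < 0" "c \<bullet> b' < 0"
      using adj adj' tc by (simp_all add: inner_commute)
    then have "p' \<in> {p, q, r}" "b \<in> {p, q, r}" "b' \<in> {p, q, r}"
      using simple_degree_le_3[OF c d] D by blast+
    \<comment> \<open>As \<delta> vanishes at \<open>c\<close>, its support stays in the arm, so the
      neighbour \<open>p'\<close> of \<open>c\<close> is \<open>q\<close>. One of the two
      continuations beyond \<open>c\<close> is then \<open>r\<close>.\<close>
    moreover have "0 < cf \<theta> p'"
      using saturated_off_support[OF th(1) del(1) _ vD(1) del(2) vD(3) D(2) del(3)] del(4) tc by simp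
    then have "p' = q" using only_q[OF D(2)] adj' tc by simp
    ultimately have "b = r \<or> b' = r" using d d' by auto
    then show False using I3 nI tc \<open>p' = q\<close> by auto
  qed
qed

end

section \<open>Supersolvable partitions\<close>

text \<open>Turns a supersolvable partition into a chain of flats, with \<open>F i\<close> the union
  of the first \<open>i\<close> blocks.\<close>

lemma supersolvable_filtration:
  fixes A :: "'a::euclidean_space set"
  assumes "supersolvable A" and nonpar: "\<And>x y. x \<in> A \<Longrightarrow> y \<in> A \<Longrightarrow> x \<noteq> y \<Longrightarrow> y \<notin> span {x}"
  obtains F :: "nat \<Rightarrow> 'a set" and n where "F 0 = {}" "F n = A" "\<And>i. F i \<subseteq> F (Suc i)"
    "\<And>i x. i \<le> n \<Longrightarrow> x \<in> A \<Longrightarrow> x \<in> span (F i) \<Longrightarrow> x \<in> F i"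
    "\<And>i x y. i < n \<Longrightarrow> x \<in> F (Suc i) - F i \<Longrightarrow> y \<in> F (Suc i) - F i \<Longrightarrow> x \<noteq> y \<Longrightarrow>
       \<exists>z\<in>F i. z \<in> span {x, y}"
proof -
  obtain B :: "nat \<Rightarrow> 'a set" where un: "(\<Union>i\<in>{1..dim A}. B i) = A"
    and B: "\<forall>i\<in>{1..dim A}. dim (\<Union>j\<in>{1..i}. B j) = i \<and>
      \<not> (\<exists>S. k_flat 2 (\<Union>j\<in>{1..i}. B j) S \<and> S \<subseteq> B i)"
    using assms(1) unfolding supersolvable_def Let_def by (elim exE conjE) (rule that)
  define F where "F i = (\<Union>j\<in>{1..i}. B j)" for i
  have F0: "F 0 = {}" and FS: "F (Suc i) = F i \<union> B (Suc i)" for i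
    by (auto simp: F_def atLeastAtMostSuc_conv)
  have mono: "F i \<subseteq> F j" if "i \<le> j" for i j unfolding F_def by (intro UN_mono) (use that in auto)
  have Fn: "F (dim A) = A" using un by (simp add: F_def)
  have dimF: "dim (F i) = i" if "i \<le> dim A" for i
    using B that by (cases "i = 0") (auto simp: F_def)
  have flat: "\<exists>z\<in>F i. z \<in> span {x, y}"
    if i: "i < dim A" and x: "x \<in> F (Suc i) - F i" and y: "y \<in> F (Suc i) - F i" and xy: "x \<noteq> y" for i x y
  proof -
    \<comment> \<open>The closure of two nonparallel vectors is a 2-flat, so it cannot stay inside
      the block \<open>B (Suc i)\<close>.\<close>
    define S where "S = closure_in (F (Suc i)) {x, y}"
    have A: "x \<in> A" "y \<in> A" using x y mono[of "Suc i" "dim A"] i Fn by auto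
    have xyS: "{x, y} \<subseteq> S" using x y by (auto simp: S_def closure_in_def intro: span_base)
    have S: "S \<subseteq> span {x, y}" by (auto simp: S_def closure_in_def)
    have sp: "span S = span {x, y}" using S xyS
      by (intro subset_antisym span_minimal span_mono subspace_span)
    have "y \<noteq> 0" using nonpar[OF A xy] span_zero by auto
    then have "independent {x, y}"
      using nonpar[OF A(2,1)] xy by (intro independent_insertI) (auto simp: independent_empty)
    then have "dim S = 2" using sp xy dim_eq_card[of "{x, y}" S] by simp
    moreover have "closure_in (F (Suc i)) S = S" unfolding closure_in_def sp by (simp add: S_def closure_in_def)
    ultimately have "k_flat 2 (F (Suc i)) S" by (auto simp: k_flat_def S_def closure_in_def)
    then have "\<not> S \<subseteq> B (Suc i)" using B i unfolding F_def by auto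
    then obtain z where "z \<in> S" "z \<notin> B (Suc i)" by auto
    then have "z \<in> F i" "z \<in> span {x, y}" using FS S by (auto simp: S_def closure_in_def)
    then show ?thesis by blast
  qed
  \<comment> \<open>Suppose \<open>x\<close> enters only later, in block \<open>Suc k\<close>. For
    any other \<open>y\<close> of that block, the plane of \<open>x\<close> and \<open>y\<close>
    contains an element of \<open>F k\<close> not parallel to \<open>x\<close>, so \<open>y\<close>
    is in the span of \<open>F k\<close>. The rank could then not grow at that block.\<close>
  have closed: "x \<in> F i" if i: "i \<le> dim A" and x: "x \<in> A" "x \<in> span (F i)" for i x
  proof (rule ccontr)
    assume n: "x \<notin> F i"
    define j where "j = (LEAST j. x \<in> F j)"
    have xn: "x \<in> F (dim A)" using x Fn by simp
    have j: "x \<in> F j" unfolding j_def using xn by (rule LeastI)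
    have jmin: "j \<le> k" if "x \<in> F k" for k unfolding j_def using that by (rule Least_le)
    have jn: "j \<le> dim A" using jmin xn .
    have ij: "i < j" using mono[of j i] j n by (cases "i < j") auto
    then obtain k where k: "j = Suc k" by (cases j) auto
    have xk: "x \<notin> F k" using jmin k by force
    have xs: "x \<in> span (F k)" using x span_mono[OF mono[of i k]] ij k by auto
    have "y \<in> span (F k)" if y: "y \<in> F j" for y
    proof (cases "y \<in> F k \<or> y = x")
      case True then show ?thesis using xs span_base by auto
    next
      case False
      then obtain z where z: "z \<in> F k" "z \<in> span {x, y}" using flat[of k x y] y xk j jn k by auto
      then have "z \<in> span {y, x}" by (simp add: insert_commute)
      then obtain s where "z - s *\<^sub>R y \<in> span {x}" unfolding span_breakdown_eq by auto
      then obtain t where st: "z - s *\<^sub>R y = t *\<^sub>R x" unfolding span_singleton by auto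
      have zA: "z \<in> A" "z \<noteq> x" using z xk mono[of k "dim A"] jn k Fn by auto
      have "s \<noteq> 0" using nonpar[OF x(1) zA(1)] zA st by (auto simp: span_singleton)
      moreover have "z - t *\<^sub>R x = s *\<^sub>R y" unfolding st[symmetric] by simp
      ultimately have "y = (1 / s) *\<^sub>R (z - t *\<^sub>R x)" by simp
      then show ?thesis using z xs by (auto intro!: span_scale span_diff intro: span_base)
    qed
    then have "dim (F j) \<le> dim (F k)" by (intro dim_mono) auto
    then show False using dimF jn k by auto
  qed
  show ?thesis using that[of F "dim A", OF F0 Fn _ closed flat] FS by blast
qed

text \<open>\<open>F\<close> is appended as the last block. A 2-flat inside \<open>F\<close> would
  contain two of its vectors, and with them the vector of \<open>J\<close> in their plane.\<close>

lemma supersolvable_extend: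
  fixes J F :: "'a::euclidean_space set"
  assumes "supersolvable J" "J \<inter> F = {}" "F \<noteq> {}" and dim: "dim (J \<union> F) = Suc (dim J)"
    and line: "\<And>x y. x \<in> F \<Longrightarrow> y \<in> F \<Longrightarrow> x \<noteq> y \<Longrightarrow> \<exists>z\<in>J. z \<in> span {x, y}"
  shows "supersolvable (J \<union> F)"
proof -
  define n where "n = dim J"
  obtain B :: "nat \<Rightarrow> 'a set" where disj: "disjoint_family_on B {1..n}"
    and ne: "\<forall>i\<in>{1..n}. B i \<noteq> {}"
    and un: "(\<Union>i\<in>{1..n}. B i) = J"
    and B: "\<forall>i\<in>{1..n}. dim (\<Union>j\<in>{1..i}. B j) = i \<and>
      \<not> (\<exists>S. k_flat 2 (\<Union>j\<in>{1..i}. B j) S \<and> S \<subseteq> B i)"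
    using assms(1) unfolding supersolvable_def Let_def n_def[symmetric] by (elim exE conjE) (rule that)
  define C where "C = B(Suc n := F)"
  have CB: "C i = B i" if "i \<in> {1..n}" for i using that by (auto simp: C_def)
  have CU: "(\<Union>j\<in>{1..i}. C j) = (\<Union>j\<in>{1..i}. B j)" if "i \<le> n" for i using that CB by auto
  have Cn: "C (Suc n) = F" by (simp add: C_def)
  have CUn: "(\<Union>j\<in>{1..Suc n}. C j) = J \<union> F"
    using CU[of n] un Cn by (simp add: atLeastAtMostSuc_conv Un_commute)
  have BJ: "B i \<subseteq> J" if "i \<in> {1..n}" for i using un that by auto
  have "\<not> (\<exists>S. k_flat 2 (J \<union> F) S \<and> S \<subseteq> F)"
  proof
    assume "\<exists>S. k_flat 2 (J \<union> F) S \<and> S \<subseteq> F"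
    then obtain S where S: "closure_in (J \<union> F) S = S" "dim S = 2" "S \<subseteq> F" by (auto simp: k_flat_def)
    have "\<exists>x\<in>S. \<exists>y\<in>S. x \<noteq> y"
    proof (rule ccontr)
      assume "\<not> ?thesis"
      then have "\<exists>x. S \<subseteq> {x}" by blast
      then obtain x where "S \<subseteq> {x}" by auto
      then have "dim S \<le> card {x}" using span_superset by (intro dim_le_card) blast+
      then show False using S by simp
    qed
    then obtain x y where xy: "x \<in> S" "y \<in> S" "x \<noteq> y" by auto
    then obtain z where z: "z \<in> J" "z \<in> span {x, y}" using line S by blast
    have "span {x, y} \<subseteq> span S" using xy by (intro span_mono) auto
    then have "z \<in> S" using z S(1) by (auto simp: closure_in_def)
    then show False using z S assms(2) by auto
  qed
  moreover have "disjoint_family_on C {1..Suc n}"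
    unfolding disjoint_family_on_def
  proof (intro ballI impI)
    fix i j assume ij: "i \<in> {1..Suc n}" "j \<in> {1..Suc n}" "i \<noteq> j"
    then consider "i \<in> {1..n}" "j \<in> {1..n}" | "i \<in> {1..n}" "j = Suc n" | "j \<in> {1..n}" "i = Suc n" by force
    then show "C i \<inter> C j = {}"
    proof cases
      case 1
      then show ?thesis using disj ij(3) by (auto simp: CB disjoint_family_on_def)
    next
      case 2
      then show ?thesis using BJ[of i] CB[of i] Cn assms(2) by blast
    next
      case 3
      then show ?thesis using BJ[of j] CB[of j] Cn assms(2) by blast
    qed
  qed
  moreover have "C i \<noteq> {}" if "i \<in> {1..Suc n}" for i
    using that ne CB Cn assms(3) by (cases "i = Suc n") auto
  moreover have "dim (\<Union>j\<in>{1..i}. C j) = i \<and> \<not> (\<exists>S. k_flat 2 (\<Union>j\<in>{1..i}. C j) S \<and> S \<subseteq> C i)"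
    if "i \<in> {1..Suc n}" for i
  proof (cases "i = Suc n")
    case True
    show ?thesis unfolding True CUn Cn using calculation(1) dim n_def by simp
  next
    case False
    then have "i \<in> {1..n}" using that by auto
    then show ?thesis using B CU[of i] CB[of i] by simp
  qed
  ultimately show ?thesis unfolding supersolvable_def Let_def dim n_def[symmetric]
    using CUn by (intro exI[of _ C] conjI ballI) simp_all
qed

section \<open>Rank and orthogonal pairs in an ideal\<close>

context root_ideal
begin

text \<open>An ideal contains the simple roots in the supports of its elements, and these form a
  basis of its span.\<close>

lemma dim_I: "dim I = card (\<Delta> \<inter> I)"
proof -
  have "x \<in> span (\<Delta> \<inter> I)" if x: "x \<in> I" for x
  proof -
    have xp: "x \<in> Pos" using I_pos x by auto
    have "cf x a *\<^sub>R a \<in> span (\<Delta> \<inter> I)" if "a \<in> \<Delta>" for a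
    proof (cases "cf x a = 0")
      case False
      then have "a \<in> I" using I_simple[OF x that] pos_cf_ge_0[OF xp, of a] by auto
      then show ?thesis using that by (auto intro: span_scale span_base)
    qed (simp add: span_zero)
    then have "(\<Sum>a\<in>\<Delta>. cf x a *\<^sub>R a) \<in> span (\<Delta> \<inter> I)" by (rule span_sum)
    then show ?thesis using cf_sum xp pos_span by auto
  qed
  then have "I \<subseteq> span (\<Delta> \<inter> I)" by auto
  then have "span I = span (\<Delta> \<inter> I)" by (metis Int_lower2 span_eq span_superset subset_trans)
  moreover have "independent (\<Delta> \<inter> I)" using indep independent_mono by blast
  ultimately show ?thesis using dim_eq_card by metis
qed

lemma ideal_minus_above: "v \<in> \<Delta> \<Longrightarrow> root_ideal \<Phi> \<Delta> (I - above v)"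
proof
  assume v: "v \<in> \<Delta>"
  show "order_ideal le Pos (I - above v)"
    unfolding order_ideal_def
  proof (intro conjI ballI impI)
    show "I - above v \<subseteq> Pos" using I_pos by auto
    fix x y assume "x \<in> I - above v" "y \<in> Pos" "le y x \<and> y \<noteq> x"
    then show "y \<in> I - above v" using I_down[of x y] v by (force simp: above_def root_le_def)
  qed
qed

lemma nonparallel: assumes "x \<in> I" "y \<in> I" "x \<noteq> y" shows "y \<notin> span {x}"
proof
  assume "y \<in> span {x}"
  then obtain c where c: "y = c *\<^sub>R x" by (auto simp: span_singleton)
  then have "c = 1 \<or> c = -1" using reduced[of x c] assms I_pos pos_root by auto
  then show False using c assms pos_minus[of x] I_pos[of x] I_pos[of "- x"] by auto
qed

text \<open>Write \<open>z\<close> as \<open>s\<close> times \<open>x\<close> plus \<open>t\<close>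
  times \<open>y\<close>. It shares a support node with \<open>x\<close> or \<open>y\<close>, so all
  three norms agree, and \<open>2 * s\<close>, \<open>2 * t\<close> are Cartan integers. Their
  squares add up to 4, which forces one of them to vanish.\<close>

lemma orthogonal_pair_span:
  assumes "x \<in> I" "y \<in> I" "x \<bullet> y = 0" "x \<bullet> x = y \<bullet> y" "z \<in> I" "z \<in> span {x, y}"
  shows "z = x \<or> z = y"
proof -
  obtain s t where "z - s *\<^sub>R x = t *\<^sub>R y"
    using assms(6) by (metis span_breakdown_eq span_singleton rangeE)
  then have z: "z = s *\<^sub>R x + t *\<^sub>R y" by (simp add: algebra_simps)
  have P: "x \<in> Pos" "y \<in> Pos" "z \<in> Pos" using assms I_pos by auto
  define N where "N = x \<bullet> x"
  have N: "0 < N" "y \<bullet> y = N" using pos_nonzero P assms by (auto simp: N_def)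
  have zx: "z \<bullet> x = s * N" and zy: "z \<bullet> y = t * N"
    using assms N by (simp_all add: z inner_add_left inner_commute[of y x] N_def)
  obtain a where a: "a \<in> \<Delta>" "0 < cf z a" using pos_obtain_cf P by blast
  have "cf z a = s * cf x a + t * cf y a"
    using P by (simp add: z cf_add cf_scale span_scale pos_span)
  then have "0 < cf x a \<or> 0 < cf y a"
    using a pos_cf_ge_0[OF P(1), of a] pos_cf_ge_0[OF P(2), of a]
    by (cases "cf x a = 0"; cases "cf y a = 0") auto
  then have "z \<bullet> z = N"
    using norm_support[OF P(1) a(1)] norm_support[OF P(2) a(1)] norm_support[OF P(3) a] N
    by (auto simp: N_def)
  moreover have "z \<bullet> z = s * (z \<bullet> x) + t * (z \<bullet> y)"
    by (subst (2) z) (simp add: inner_add_right)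
  ultimately have "(s * s + t * t) * N = 1 * N" using zx zy by (simp add: algebra_simps)
  then have st: "s * s + t * t = 1" using N by simp
  have "2 * s = cartan_int z x" "2 * t = cartan_int z y"
    using N zx zy by (simp_all add: cartan_int_def N_def)
  then have "2 * s \<in> \<int>" "2 * t \<in> \<int>" using cartan_Ints P pos_root by auto
  then obtain m k where mk: "2 * s = of_int m" "2 * t = of_int k" by (elim Ints_cases)
  have "4 = (2 * s) * (2 * s) + (2 * t) * (2 * t)" using st by (simp add: algebra_simps)
  then have "real_of_int 4 = real_of_int (m * m + k * k)" unfolding mk by simp
  then have "4 = m * m + k * k" unfolding of_int_eq_iff .
  moreover have "m = 0 \<or> k = 0"
  proof (rule ccontr)
    assume nz: "\<not> ?thesis"
    have "m * m \<le> 4" "k * k \<le> 4"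
      using \<open>4 = m * m + k * k\<close> zero_le_square[of m] zero_le_square[of k] by linarith+
    then have "m\<^sup>2 \<le> 2\<^sup>2" "k\<^sup>2 \<le> 2\<^sup>2" by (simp_all add: power2_eq_square)
    then have "\<bar>m\<bar> \<le> 2" "\<bar>k\<bar> \<le> 2" unfolding abs_le_square_iff[symmetric] by simp_all
    then have "m \<in> {-2, -1, 1, 2}" "k \<in> {-2, -1, 1, 2}" using nz by auto
    then show False using \<open>4 = m * m + k * k\<close> by auto
  qed
  then consider "s = 0" | "t = 0" using mk by auto
  then show ?thesis
  proof cases
    case 1
    then have "z \<in> span {y}" by (simp add: z span_base span_scale)
    then show ?thesis using nonparallel assms by blast
  next
    case 2
    then have "z \<in> span {x}" by (simp add: z span_base span_scale)
    then show ?thesis using nonparallel assms by blast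
  qed
qed

end

section \<open>Supersolvable ideals contain no star\<close>

lemma (in simply_laced_root_system) three_sum_norm:
  assumes "x \<in> \<Delta>" "y \<in> \<Delta>" "z \<in> \<Delta>" "distinct [x, y, z]" "x + y + z \<in> Pos"
  shows "y \<bullet> y = x \<bullet> x" "z \<bullet> z = x \<bullet> x" "x \<bullet> y + x \<bullet> z + y \<bullet> z = - (x \<bullet> x)"
proof -
  let ?r = "x + y + z"
  \<comment> \<open>All three lie in the support of the sum and so have its length. Expanding the
    norm then says that there are exactly two edges among them.\<close>
  have c: "0 < cf ?r x" "0 < cf ?r y" "0 < cf ?r z"
    using assms(1-4) by (auto simp: cf_add simple_span span_add cf_simple)
  have n: "x \<bullet> x = ?r \<bullet> ?r" "y \<bullet> y = ?r \<bullet> ?r" "z \<bullet> z = ?r \<bullet> ?r"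
    using norm_support[OF assms(5)] assms c by auto
  have "?r \<bullet> ?r = x \<bullet> x + y \<bullet> y + z \<bullet> z + 2 * (x \<bullet> y + x \<bullet> z + y \<bullet> z)"
    by (simp add: inner_add_left inner_add_right inner_commute)
  moreover define R where "R = ?r \<bullet> ?r"
  ultimately have "R = x \<bullet> x + y \<bullet> y + z \<bullet> z + 2 * (x \<bullet> y + x \<bullet> z + y \<bullet> z)"
    and "x \<bullet> x = R" "y \<bullet> y = R" "z \<bullet> z = R" using n by metis+
  then show "y \<bullet> y = x \<bullet> x" "z \<bullet> z = x \<bullet> x" "x \<bullet> y + x \<bullet> z + y \<bullet> z = - (x \<bullet> x)" by simp_all
qed

text \<open>Meant for a star with centre \<open>e\<close> and two outer nodes \<open>a\<close>,
  \<open>b\<close> already in \<open>U\<close>: a root of height 2 gives the centre, and then a root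
  of height 3 gives the third outer node.\<close>

lemma subspace_star_step:
  assumes "subspace U" "a \<in> U" "b \<in> U" "a + e \<in> U \<or> b + e \<in> U" "a + e + c \<in> U \<or> b + e + c \<in> U"
  shows "e \<in> U" "c \<in> U"
proof -
  show e: "e \<in> U" using assms subspace_diff[OF assms(1)] by (metis add_diff_cancel_left')
  have "a + e \<in> U" "b + e \<in> U" using assms e subspace_add by auto
  then show "c \<in> U" using assms subspace_diff[OF assms(1)] by (metis add_diff_cancel_left')
qed

lemma (in root_ideal) supersolvable_not_star:
  assumes "supersolvable I" shows "\<not> star_ideal \<Phi> \<Delta> I"
proof
  assume "star_ideal \<Phi> \<Delta> I"
  then obtain a e b c where D: "a \<in> \<Delta>" "e \<in> \<Delta>" "b \<in> \<Delta>" "c \<in> \<Delta>" and d: "distinct [a, e, b, c]"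
    and I3: "a + e + b \<in> I" "a + e + c \<in> I" "e + b + c \<in> I"
    unfolding star_ideal_def by auto
  define N where "N = e \<bullet> e"
  have N: "0 < N" using pos_nonzero simple_pos D by (simp add: N_def)
  note n1 = three_sum_norm[OF D(1,2,3) _ I_pos[OF I3(1)]]
  note n2 = three_sum_norm[OF D(1,2,4) _ I_pos[OF I3(2)]]
  note n3 = three_sum_norm[OF D(2,3,4) _ I_pos[OF I3(3)]]
  have nn: "a \<bullet> a = N" "b \<bullet> b = N" "c \<bullet> c = N" "e \<bullet> e = N"
    using n1 n2 n3 d by (auto simp: N_def)
  have s: "a \<bullet> e + a \<bullet> b + e \<bullet> b = - N" "a \<bullet> e + a \<bullet> c + e \<bullet> c = - N" "e \<bullet> b + e \<bullet> c + b \<bullet> c = - N"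
    using n1(3) n2(3) n3(3) d nn by auto
  \<comment> \<open>Edges are counted. Each of the three triples through \<open>e\<close> carries
    two, and the positive norm of the sum of all four nodes allows at most three in total. So
    \<open>e\<close> is joined to \<open>a\<close>, \<open>b\<close> and \<open>c\<close>, and there
    are no other edges.\<close>
  have dich: "x \<bullet> y = 0 \<or> 2 * (x \<bullet> y) = - N" if "x \<in> \<Delta>" "y \<in> \<Delta>" "x \<noteq> y" "y \<bullet> y = N" for x y
    using simple_inner_nonpos[OF that(1-3)] adjacent_norm(2)[OF that(1,2)] that(4) by linarith
  have t: "a + e + b + c \<noteq> 0"
  proof
    assume "a + e + b + c = 0"
    then have "cf (a + e + b + c) a = 0" by (simp add: cf_zero)
    then show False using D d by (simp add: cf_add simple_span span_add cf_simple)
  qed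
  have "0 < (a + e + b + c) \<bullet> (a + e + b + c)" using t by simp
  moreover have "(a + e + b + c) \<bullet> (a + e + b + c) = a \<bullet> a + e \<bullet> e + b \<bullet> b + c \<bullet> c
     + (2 * (a \<bullet> e) + 2 * (a \<bullet> b) + 2 * (a \<bullet> c) + 2 * (e \<bullet> b) + 2 * (e \<bullet> c) + 2 * (b \<bullet> c))"
    by (simp add: inner_add_left inner_add_right inner_commute)
  moreover define R where "R = (a + e + b + c) \<bullet> (a + e + b + c)"
  ultimately have "0 < R" "R = N + N + N + N
     + (2 * (a \<bullet> e) + 2 * (a \<bullet> b) + 2 * (a \<bullet> c) + 2 * (e \<bullet> b) + 2 * (e \<bullet> c) + 2 * (b \<bullet> c))"
    unfolding nn by metis+
  then have "- 2 * N < a \<bullet> e + a \<bullet> b + a \<bullet> c + e \<bullet> b + e \<bullet> c + b \<bullet> c" by linarith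
  moreover have "a \<bullet> e = 0 \<or> 2 * (a \<bullet> e) = - N" "a \<bullet> b = 0 \<or> 2 * (a \<bullet> b) = - N" "a \<bullet> c = 0 \<or> 2 * (a \<bullet> c) = - N"
    "e \<bullet> b = 0 \<or> 2 * (e \<bullet> b) = - N" "e \<bullet> c = 0 \<or> 2 * (e \<bullet> c) = - N" "b \<bullet> c = 0 \<or> 2 * (b \<bullet> c) = - N"
    using dich D d nn by auto
  ultimately have ip: "2 * (a \<bullet> e) = - N" "2 * (e \<bullet> b) = - N" "2 * (e \<bullet> c) = - N" "a \<bullet> b = 0" "a \<bullet> c = 0" "b \<bullet> c = 0"
    using s N by linarith+
  note ip' = ip[unfolded inner_commute[of a e] inner_commute[of e b] inner_commute[of e c]
      inner_commute[of a b] inner_commute[of a c] inner_commute[of b c]]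
  have neg: "a \<bullet> e < 0" "b \<bullet> e < 0" "c \<bullet> e < 0" using ip ip' N by linarith+
  have ae: "a + e \<in> I" "b + e \<in> I" "c + e \<in> I"
  proof -
    have "e + a \<in> Pos" "e + b \<in> Pos" "e + c \<in> Pos"
      using path3_pos(1)[OF D(1,2,3)] path3_pos(1)[OF D(3,2,4)] path3_pos(1)[OF D(4,2,1)] neg d by auto
    moreover have "le (e + a) (a + e + b)" "le (e + b) (a + e + b)" "le (e + c) (a + e + c)"
      using D by (auto simp: root_le_def cf_add simple_span span_add cf_simple)
    ultimately show "a + e \<in> I" "b + e \<in> I" "c + e \<in> I"
      using I_down[OF I3(1)] I_down[OF I3(2)] by (simp_all add: add.commute)
  qed
  have simp_I: "a \<in> I" "e \<in> I" "b \<in> I" "c \<in> I"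
    using I_simple[OF I3(1) D(1)] I_simple[OF I3(1) D(2)] I_simple[OF I3(1) D(3)] I_simple[OF I3(2) D(4)] D
    by (auto simp: cf_add simple_span span_add cf_simple)
  have bce: "b + e + c \<in> I" using I3(3) by (simp add: add.commute)
  obtain F :: "nat \<Rightarrow> 'a set" and n where F: "F 0 = {}" "F n = I" "\<And>i. F i \<subseteq> F (Suc i)"
    and closed: "\<And>i x. i \<le> n \<Longrightarrow> x \<in> I \<Longrightarrow> x \<in> span (F i) \<Longrightarrow> x \<in> F i"
    and flat: "\<And>i x y. i < n \<Longrightarrow> x \<in> F (Suc i) - F i \<Longrightarrow> y \<in> F (Suc i) - F i \<Longrightarrow> x \<noteq> y \<Longrightarrow>
       \<exists>z\<in>F i. z \<in> span {x, y}"
    by (rule supersolvable_filtration[OF assms]) (rule nonparallel, assumption+, rule that)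
  \<comment> \<open>\<open>F i\<close> is the union of the first \<open>i\<close> blocks, so block \<open>i\<close> completes the star.\<close>
  define i where "i = (LEAST i. {a, b, c, e} \<subseteq> F i)"
  have i_n: "{a, b, c, e} \<subseteq> F n" using F simp_I by simp
  have i_F: "{a, b, c, e} \<subseteq> F i" unfolding i_def using i_n by (rule LeastI)
  have imin: "i \<le> k" if "{a, b, c, e} \<subseteq> F k" for k unfolding i_def using that by (rule Least_le)
  note i = i_F imin[OF i_n]
  obtain k where k: "i = Suc k" using F(1) i by (cases i) auto
  define U where "U = span (F k)"
  have U: "subspace U" by (simp add: U_def)
  have FI: "F j \<subseteq> I" if "j \<le> n" for j
    using that F(2) lift_Suc_mono_le[of F j n, OF F(3)] by simp
  \<comment> \<open>Both roots are in \<open>F i\<close>, a flat that contains the star. If neither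
    were in \<open>U\<close>, both would be in the last block of \<open>F i\<close>, and their plane
    would contain an element of \<open>F k\<close>, contrary to
    \<open>orthogonal_pair_span\<close>.\<close>
  have pair: "x \<in> U \<or> y \<in> U"
    if xy: "x \<in> I" "y \<in> I" "x \<in> span {a, b, c, e}" "y \<in> span {a, b, c, e}" "x \<bullet> y = 0" "x \<bullet> x = y \<bullet> y" for x y
  proof (rule ccontr)
    assume n: "\<not> (x \<in> U \<or> y \<in> U)"
    have "span {a, b, c, e} \<subseteq> span (F i)" using i by (intro span_mono)
    then have "x \<in> F i" "y \<in> F i" using closed[OF i(2)] xy by auto
    moreover have "x \<notin> F k" "y \<notin> F k" using n by (auto simp: U_def span_base)
    moreover have "x \<noteq> y" using xy pos_nonzero[OF I_pos] by force
    ultimately obtain z where z: "z \<in> F k" "z \<in> span {x, y}" using flat[of k x y] i k by auto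
    have "z \<in> I" using FI[of k] i k z by auto
    then show False using orthogonal_pair_span[OF xy(1,2,5,6) _ z(2)] z(1) \<open>x \<notin> F k\<close> \<open>y \<notin> F k\<close> by auto
  qed
  have sp: "x \<in> span {a, b, c, e}" if "x \<in> {a, b, c, e}" for x using that by (rule span_base)
  have sp2: "a + e \<in> span {a, b, c, e}" "b + e \<in> span {a, b, c, e}" "c + e \<in> span {a, b, c, e}"
    by (intro span_add sp; simp)+
  have half: "a \<bullet> e = - (N / 2)" "b \<bullet> e = - (N / 2)" "c \<bullet> e = - (N / 2)"
    "e \<bullet> a = - (N / 2)" "e \<bullet> b = - (N / 2)" "e \<bullet> c = - (N / 2)"
    using ip ip' by linarith+
  note calc = inner_add_left inner_add_right nn half ip(4-6) ip'(4-6)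
  \<comment> \<open>The three sets of pairwise orthogonal roots are the outer nodes, their sums with
    \<open>e\<close>, and the roots of height 3.\<close>
  have q: "(a + e + b) \<bullet> (a + e + c) = 0" "(a + e + b) \<bullet> (b + e + c) = 0" "(a + e + c) \<bullet> (b + e + c) = 0"
    "(a + e + b) \<bullet> (a + e + b) = N" "(a + e + c) \<bullet> (a + e + c) = N" "(b + e + c) \<bullet> (b + e + c) = N"
    "(a + e) \<bullet> (b + e) = 0" "(a + e) \<bullet> (c + e) = 0" "(b + e) \<bullet> (c + e) = 0"
    "(a + e) \<bullet> (a + e) = N" "(b + e) \<bullet> (b + e) = N" "(c + e) \<bullet> (c + e) = N"
    by (simp_all add: calc)
  have p1: "a \<in> U \<or> b \<in> U" "a \<in> U \<or> c \<in> U" "b \<in> U \<or> c \<in> U"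
    using pair[OF simp_I(1,3)] pair[OF simp_I(1,4)] pair[OF simp_I(3,4)] ip nn sp by simp_all
  have p2: "a + e \<in> U \<or> b + e \<in> U" "a + e \<in> U \<or> c + e \<in> U" "b + e \<in> U \<or> c + e \<in> U"
    using pair[OF ae(1,2)] pair[OF ae(1,3)] pair[OF ae(2,3)] q sp2 by simp_all
  have sp3: "a + e + b \<in> span {a, b, c, e}" "a + e + c \<in> span {a, b, c, e}" "b + e + c \<in> span {a, b, c, e}"
    by (intro span_add sp; simp)+
  have p3: "a + e + b \<in> U \<or> a + e + c \<in> U" "a + e + b \<in> U \<or> b + e + c \<in> U" "a + e + c \<in> U \<or> b + e + c \<in> U"
    using pair[OF I3(1,2)] pair[OF I3(1) bce] pair[OF I3(2) bce] q sp3 by simp_all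
  have "{a, b, c, e} \<subseteq> U"
  proof -
    consider "a \<in> U" "b \<in> U" | "a \<in> U" "c \<in> U" | "b \<in> U" "c \<in> U" using p1 by blast
    then show ?thesis
    proof cases
      case 1
      then show ?thesis using subspace_star_step[OF U 1 p2(1) p3(3)] by blast
    next
      case 2
      have "a + e + b \<in> U \<or> c + e + b \<in> U" using p3(2) by (simp only: add_ac)
      from subspace_star_step[OF U 2 p2(2) this] show ?thesis using 2 by blast
    next
      case 3
      have "b + e + a \<in> U \<or> c + e + a \<in> U" using p3(1) by (simp only: add_ac)
      from subspace_star_step[OF U 3 p2(3) this] show ?thesis using 3 by blast
    qed
  qed
  moreover have "x \<in> F k" if "x \<in> {a, b, c, e}" "x \<in> U" for x
    by (rule closed) (use i k simp_I that U_def in auto)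
  ultimately have "{a, b, c, e} \<subseteq> F k" by blast
  then show False using imin[of k] k by simp
qed

section \<open>Peeling\<close>

context nonstar_ideal
begin

lemma nonstar_minus_above: assumes "v \<in> \<Delta>" shows "nonstar_ideal \<Phi> \<Delta> (I - above v)"
proof -
  interpret J: root_ideal \<Phi> \<Delta> "I - above v" by (rule ideal_minus_above[OF assms])
  show ?thesis
  proof
    show "\<not> star_ideal \<Phi> \<Delta> (I - above v)"
    proof
      assume "star_ideal \<Phi> \<Delta> (I - above v)"
      then have "star_ideal \<Phi> \<Delta> I" using ideal unfolding star_ideal_def by blast
      then show False using nonstar by simp
    qed
  qed
qed

end

section \<open>Both structures by removing one chain at a time\<close>

context simply_laced_root_system
begin

text \<open>Induction on the size of \<open>I\<close>, with the same set in both roles: the chain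
  above \<open>v\<close> is the last block of the supersolvable partition and the first chain to be
  peeled off.\<close>

lemma nonstar_imp_supersolvable_peelable:
  assumes "nonstar_ideal \<Phi> \<Delta> I"
  shows "supersolvable I \<and> chain_peelable le I"
  using assms
proof (induction "card I" arbitrary: I rule: less_induct)
  case less
  interpret I: nonstar_ideal \<Phi> \<Delta> I by fact
  show ?case
  proof (cases "I = {}")
    case True
    \<comment> \<open>The empty ideal has rank 0 and hence a supersolvable partition without blocks,
      whereas its chain peeling has one empty block.\<close>
    have "chain_peeling le {} [{}]"
      by (rule chain_peeling.chain) (simp add: Complete_Partial_Order.chain_def)
    then show ?thesis using True
      by (auto simp: supersolvable_def chain_peelable_def disjoint_family_on_def)
  next
    case False
    then obtain v where v: "v \<in> \<Delta>" "v \<in> I" and ch: "Complete_Partial_Order.chain le (I.above v)"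
      using I.exists_chain_above by blast
    define F J where "F = I.above v" and "J = I - I.above v"
    have vF: "v \<in> F" using v by (simp add: F_def I.above_def cf_simple)
    have IJ: "I = J \<union> F" "J \<inter> F = {}" "J = I - F" by (auto simp: F_def J_def I.above_def)
    interpret J: nonstar_ideal \<Phi> \<Delta> J unfolding J_def by (rule I.nonstar_minus_above[OF v(1)])
    have "J \<subset> I" using vF v(2) IJ(3) by blast
    then have "card J < card I" using I.finite_I by (rule psubset_card_mono[rotated])
    then have IH: "supersolvable J" "chain_peelable le J" using less.hyps J.nonstar_ideal_axioms by blast+
    \<comment> \<open>The only simple root above \<open>v\<close> is \<open>v\<close> itself, so the
      rank drops by exactly one.\<close>
    have "\<Delta> \<inter> I = insert v (\<Delta> \<inter> J)" "v \<notin> \<Delta> \<inter> J"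
    proof -
      have "cf b v = (if v = b then 1 else 0)" if "b \<in> \<Delta>" for b using that by (rule cf_simple)
      then have "b \<in> F \<longleftrightarrow> b = v" if "b \<in> \<Delta>" "b \<in> I" for b
        using that by (auto simp: F_def I.above_def)
      then show "\<Delta> \<inter> I = insert v (\<Delta> \<inter> J)" "v \<notin> \<Delta> \<inter> J"
        using v unfolding IJ(3) by blast+
    qed
    then have dim: "dim I = Suc (dim J)" using I.dim_I J.dim_I finite_simple by simp
    have "\<exists>z\<in>J. z \<in> span {x, y}" if xy: "x \<in> F" "y \<in> F" "x \<noteq> y" for x y
    proof -
      have "le x y \<or> le y x" using ch xy by (auto simp: F_def Complete_Partial_Order.chain_def)
      then show ?thesis
      proof
        assume "le x y"
        from I.diff_chain_above[OF ch v(1) xy(1,2)[unfolded F_def] this xy(3)] have "y - x \<in> J"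
          by (simp only: J_def)
        moreover have "y - x \<in> span {x, y}" by (intro span_diff span_base) simp_all
        ultimately show ?thesis by blast
      next
        assume "le y x"
        from I.diff_chain_above[OF ch v(1) xy(2,1)[unfolded F_def] this xy(3)[symmetric]] have "x - y \<in> J"
          by (simp only: J_def)
        moreover have "x - y \<in> span {x, y}" by (intro span_diff span_base) simp_all
        ultimately show ?thesis by blast
      qed
    qed
    then have "supersolvable (J \<union> F)"
      using supersolvable_extend[OF IH(1) IJ(2)] vF dim unfolding IJ(1)[symmetric] by blast
    then have 1: "supersolvable I" unfolding IJ(1)[symmetric] .
    have 2: "chain_peelable le I"
    proof (cases "Complete_Partial_Order.chain le I")
      case True then show ?thesis using chain_peeling.chain by (auto simp: chain_peelable_def)
    next
      case nch: False
      obtain Ps where Ps: "chain_peeling le J Ps" using IH by (auto simp: chain_peelable_def)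
      have filt: "order_filter le I F"
        unfolding order_filter_def order_ideal_def IJ(3)[symmetric]
      proof (intro conjI ballI impI)
        show "F \<subseteq> I" "J \<subseteq> I" using IJ(1) by blast+
        fix x y assume "x \<in> J" "y \<in> I" "le y x \<and> y \<noteq> x"
        then show "y \<in> J" using J.I_down[of x y] I.I_pos[of y] by simp
      qed
      have vmin: "minimal_in le I v"
        unfolding minimal_in_def
      proof (intro conjI ballI impI)
        show "v \<in> I" by (fact v)
        fix x assume x: "x \<in> I" "le x v"
        have xp: "x \<in> Pos" using I.I_pos x by auto
        show "x = v"
        proof (rule pos_multiple_simple[OF xp v(1)])
          fix b assume "b \<in> \<Delta>" "b \<noteq> v"
          then show "cf x b = 0" using x(2) v(1) pos_cf_ge_0[OF xp, of b]
            unfolding root_le_def by (metis antisym cf_simple)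
        qed
      qed
      have "chain_peeling le I (Ps @ [F])"
      proof (rule chain_peeling.peel[OF nch])
        show "\<exists>m\<in>F. minimal_in le I m" using vF vmin by blast
        show "order_filter le I F" by (fact filt)
        show "Complete_Partial_Order.chain le F" using ch by (simp only: F_def)
        show "chain_peeling le (I - F) Ps" using Ps by (simp only: IJ(3)[symmetric])
      qed
      then show ?thesis by (auto simp: chain_peelable_def)
    qed
    show ?thesis using 1 2 by simp
  qed
qed

text \<open>Induction along the peeling: the three incomparable roots of height 3 survive every
  step, so no chain is ever reached.\<close>

lemma star_not_peelable:
  assumes "chain_peeling le I Ps" "root_ideal \<Phi> \<Delta> I" "star_ideal \<Phi> \<Delta> I"
  shows False
  using assms
proof (induction rule: chain_peeling.induct)
  case (chain P)
  interpret root_ideal \<Phi> \<Delta> P by fact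
  obtain a b c d where D: "a \<in> \<Delta>" "b \<in> \<Delta>" "c \<in> \<Delta>" "d \<in> \<Delta>" "distinct [a, b, c, d]"
    and r: "a + b + c \<in> P" "a + b + d \<in> P"
    using chain.prems unfolding star_ideal_def by auto
  then have "\<not> le (a + b + c) (a + b + d)" "\<not> le (a + b + d) (a + b + c)"
    by (auto simp: root_le_def cf_add simple_span span_add cf_simple)
  then show False using chain.hyps r by (auto simp: Complete_Partial_Order.chain_def)
next
  case (peel P F Ps)
  interpret root_ideal \<Phi> \<Delta> P by fact
  obtain a b c d where D: "a \<in> \<Delta>" "b \<in> \<Delta>" "c \<in> \<Delta>" "d \<in> \<Delta>" "distinct [a, b, c, d]"
    and r: "a + b + c \<in> P" "a + b + d \<in> P" "b + c + d \<in> P"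
    using peel.prems(2) unfolding star_ideal_def by auto
  define R where "R = {a + b + c, a + b + d, b + c + d}"
  have cfr: "cf (a + b + c) x = (if x \<in> {a, b, c} then 1 else 0)"
    "cf (a + b + d) x = (if x \<in> {a, b, d} then 1 else 0)"
    "cf (b + c + d) x = (if x \<in> {b, c, d} then 1 else 0)" for x
    using D by (auto simp: cf_add simple_span span_add cf_simple)
  have incomp: "x = y" if "x \<in> R" "y \<in> R" "le x y" for x y
    using that D unfolding R_def root_le_def by (auto simp: cfr)
  obtain m where m: "m \<in> F" "minimal_in le P m" using peel.hyps by auto
  have mP: "m \<in> P" "m \<in> Pos" using m I_pos by (auto simp: minimal_in_def)
  have up: "x \<in> F" if "x \<in> P" "le m x" for x
    using peel.hyps(2) m(1) that mP unfolding order_filter_def order_ideal_def by blast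
  have FP: "F \<subseteq> P" using peel.hyps by (simp add: order_filter_def)
  show False
  proof (cases "R \<inter> F = {}")
    case True
    have "order_ideal le Pos (P - F)"
      unfolding order_ideal_def
    proof (intro conjI ballI impI)
      show "P - F \<subseteq> Pos" using I_pos by auto
      fix x y assume xy: "x \<in> P - F" "y \<in> Pos" "le y x \<and> y \<noteq> x"
      then have "y \<in> P" using I_down by blast
      then show "y \<in> P - F" using peel.hyps(2) xy unfolding order_filter_def order_ideal_def by blast
    qed
    moreover from this have "root_ideal \<Phi> \<Delta> (P - F)" by unfold_locales
    moreover have "R \<subseteq> \<Phi> \<inter> (P - F)" using True r I_pos pos_root by (auto simp: R_def)
    ultimately show False using peel.IH D unfolding R_def star_ideal_def by blast
  next
    case False
    then obtain x where x: "x \<in> R" "x \<in> F" by auto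
    \<comment> \<open>The minimal element \<open>m\<close> of the filter is comparable to
      \<open>x\<close>, hence below it. Minimality in an ideal makes \<open>m\<close> simple, so it
      is a node of the star and lies below two of the three incomparable roots; the filter contains
      both and is no chain.\<close>
    have "le m x" using peel.hyps(4) x m FP unfolding Complete_Partial_Order.chain_def minimal_in_def by blast
    obtain s where s: "s \<in> \<Delta>" "0 < cf m s" using pos_obtain_cf mP by blast
    then have "s \<in> P" "le s m" using I_simple mP simple_le_iff by auto
    then have "s = m" using m by (auto simp: minimal_in_def)
    then have mD: "m \<in> \<Delta>" using s by simp
    then have "0 < cf x m" using simple_le_iff \<open>le m x\<close> x FP I_pos by auto
    then have "m \<in> {a, b, c, d}" using x(1) unfolding R_def by (auto simp: cfr split: if_splits)
    then have "\<exists>u\<in>R. \<exists>w\<in>R. u \<noteq> w \<and> 0 < cf u m \<and> 0 < cf w m"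
      using D unfolding R_def by (auto simp: cfr)
    then obtain u w where uw: "u \<in> R" "w \<in> R" "u \<noteq> w" "0 < cf u m" "0 < cf w m" by blast
    moreover have "u \<in> P" "w \<in> P" using uw r by (auto simp: R_def)
    ultimately have "u \<in> F" "w \<in> F" using up simple_le_iff[OF mD] I_pos by auto
    then show False using incomp[of u w] incomp[of w u] uw peel.hyps(4)
      unfolding Complete_Partial_Order.chain_def by metis
  qed
qed

end

theorem theorem6p6:
  fixes \<Phi> \<Delta> I :: "'a::euclidean_space set"
  assumes "root_system \<Phi>"
    and "simple_roots \<Phi> \<Delta>"
    and "simply_laced \<Delta>"
    and "order_ideal (root_le \<Delta>) (positive_roots \<Phi> \<Delta>) I"
  shows "(supersolvable I \<longleftrightarrow> chain_peelable (root_le \<Delta>) I) \<and>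
         (chain_peelable (root_le \<Delta>) I \<longleftrightarrow> \<not> star_ideal \<Phi> \<Delta> I)"
proof -
  interpret root_ideal \<Phi> \<Delta> I by unfold_locales (use assms in auto)
  have "supersolvable I \<and> chain_peelable le I" if "\<not> star_ideal \<Phi> \<Delta> I"
    by (rule nonstar_imp_supersolvable_peelable) (unfold_locales, fact that)
  moreover have "\<not> star_ideal \<Phi> \<Delta> I" if "chain_peelable le I"
    using that star_not_peelable root_ideal_axioms by (auto simp: chain_peelable_def)
  ultimately show ?thesis using supersolvable_not_star by blast
qed

end
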